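(* Let $n\ge1$ and let $H$ be the standard left-invariant contact distribution on the Heisenberg group $\mathbb{R}^{2n+1}$, so $\operatorname{rk}H=2n$. For every $l\in\{0,1,\dots,\operatorname{rk}H\}$ and every integer $t$ with $0\le t\le\min\{l,\operatorname{rk}H-l\}$ and $l-t$ even, there exists a left-invariant pseudo-Riemannian metric $g$ on $H$ with $\operatorname{ind}(g)=l$ such that $$\dim\mathfrak{I}(\mathbb{R}^{2n+1},H,g)=2n+1+\left(\tfrac12\operatorname{rk}H-t\right)^2+t^2 .$$
   Context: The Heisenberg group is $\mathbb{R}^{2n+1}$ with coordinates $(x,y,z)=(x_1,\dots,x_n,y_1,\dots,y_n,z)$ and multiplication $$(x,y,z)*(x',y',z')=\Big(x+x',\,y+y',\,z+z'+\tfrac12\sum_{i=1}^n(y_ix_i'-y_i'x_i)\Big).$$ The vector fields $X_i=\frac{\partial}{\partial x_i}+\frac12y_i\frac{\partial}{\partial z}$ and $Y_i=\frac{\partial}{\partial y_i}-\frac12x_i\frac{\partial}{\partial z}$, $i=1,\dots,n$, are left-invariant, and $H=\mathrm{span}\{X_1,Y_1,\dots,X_n,Y_n\}$ is a contact distribution. A pseudo-Riemannian metric $g$ on $H$ (a smooth non-degenerate symmetric bilinear form on the bundle $H$) is left-invariant if left translations preserve it, i.e. if it has constant coefficients in the frame $(X_i,Y_i)$. The index $\operatorname{ind}(g)$ is the number of minuses in the diagonal form of $g$ at any point. An isometry of $(M,H,g)$ is a diffeomorphism $f\colon M\to M$ such that $f_*(H)=H$ and $g(f_*v,f_*w)=g(v,w)$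 for all $q\in M$, $v,w\in H_q$. The group of all isometries, a Lie group in the compact-open topology, is denoted $\mathfrak{I}(M,H,g)$. *)

theory Defs
  imports "HOL-Analysis.Analysis" "HOL-Algebra.Group"
begin

section \<open>Smooth maps between Euclidean spaces\<close>

primrec Ck_on :: "nat \<Rightarrow> 'a::euclidean_space set \<Rightarrow> ('a \<Rightarrow> 'b::euclidean_space) \<Rightarrow> bool" where
  "Ck_on 0 S f \<longleftrightarrow> continuous_on S f"
| "Ck_on (Suc k) S f \<longleftrightarrow>
     (\<forall>x\<in>S. f differentiable (at x)) \<and> (\<forall>v. Ck_on k S (\<lambda>x. frechet_derivative f (at x) v))"

definition smooth :: "('a::euclidean_space \<Rightarrow> 'b::euclidean_space) \<Rightarrow> bool" where
  "smooth f \<longleftrightarrow> (\<forall>k. Ck_on k UNIV f)"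

definition diffeomorphism :: "('a::euclidean_space \<Rightarrow> 'b::euclidean_space) \<Rightarrow> bool" where
  "diffeomorphism f \<longleftrightarrow> bij f \<and> smooth f \<and> smooth (inv_into UNIV f)"


section \<open>Pseudo-Riemannian metrics on distributions\<close>

text \<open>A distribution on the Euclidean space 'a assigns to a point a linear subspace of 'a, which
  is identified with each of its tangent spaces; a vector field is then a map from 'a to 'a. For a
  metric g on D only the values g q v w with v and w in D q are relevant.\<close>

definition pseudo_riemannian_metric ::
  "('a::euclidean_space \<Rightarrow> 'a set) \<Rightarrow> ('a \<Rightarrow> 'a \<Rightarrow> 'a \<Rightarrow> real) \<Rightarrow> bool" where
  "pseudo_riemannian_metric D g \<longleftrightarrow>
     (\<forall>q. \<forall>u\<in>D q. \<forall>v\<in>D q. \<forall>w\<in>D q. \<forall>a b.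
        g q (a *\<^sub>R u + b *\<^sub>R v) w = a * g q u w + b * g q v w) \<and>
     (\<forall>q. \<forall>v\<in>D q. \<forall>w\<in>D q. g q v w = g q w v) \<and>
     (\<forall>q. \<forall>v\<in>D q. (\<forall>w\<in>D q. g q v w = 0) \<longrightarrow> v = 0) \<and>
     (\<forall>V W. smooth V \<and> smooth W \<and> (\<forall>q. V q \<in> D q \<and> W q \<in> D q) \<longrightarrow>
        smooth (\<lambda>q. g q (V q) (W q)))"

text \<open>Existence of a diagonalising basis of D q with exactly l negative diagonal entries; by
  Sylvester's law of inertia l does not depend on the basis.\<close>

definition has_index ::
  "('a::euclidean_space \<Rightarrow> 'a set) \<Rightarrow> ('a \<Rightarrow> 'a \<Rightarrow> 'a \<Rightarrow> real) \<Rightarrow> nat \<Rightarrow> bool" where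
  "has_index D g l \<longleftrightarrow>
     (\<forall>q. \<exists>B. independent B \<and> span B = D q \<and>
        (\<forall>b\<in>B. \<forall>c\<in>B. b \<noteq> c \<longrightarrow> g q b c = 0) \<and> card {b\<in>B. g q b b < 0} = l)"

definition isometries ::
  "('a::euclidean_space \<Rightarrow> 'a set) \<Rightarrow> ('a \<Rightarrow> 'a \<Rightarrow> 'a \<Rightarrow> real) \<Rightarrow> ('a \<Rightarrow> 'a) set" where
  "isometries D g = {f. diffeomorphism f \<and>
     (\<forall>q. frechet_derivative f (at q) ` D q = D (f q)) \<and>
     (\<forall>q. \<forall>v\<in>D q. \<forall>w\<in>D q.
        g (f q) (frechet_derivative f (at q) v) (frechet_derivative f (at q) w) = g q v w)}"

definition isometry_group ::
  "('a::euclidean_space \<Rightarrow> 'a set) \<Rightarrow> ('a \<Rightarrow> 'a \<Rightarrow> 'a \<Rightarrow> real) \<Rightarrow> ('a \<Rightarrow> 'a) monoid" where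
  "isometry_group D g = \<lparr>carrier = isometries D g, monoid.mult = (\<circ>), one = id\<rparr>"

definition compact_open_topology ::
  "('a::topological_space \<Rightarrow> 'b::topological_space) set \<Rightarrow> ('a \<Rightarrow> 'b) topology" where
  "compact_open_topology F =
     topology_generated_by {{f\<in>F. f ` K \<subseteq> U} | K U. compact K \<and> open U}"


section \<open>Lie groups\<close>

text \<open>The dimension of a Lie group has to be an ordinary natural number d rather than a type, so
  charts take values in the library space Euclidean_space d, which consists of the functions
  from nat to real that vanish at all indices i with d \<le> i. Smoothness there is expressed by
  iterated partial derivatives with respect to the first d coordinates.\<close>

primrec coord_Ck_on :: "nat \<Rightarrow> nat \<Rightarrow> (nat \<Rightarrow> real) set \<Rightarrow> ((nat \<Rightarrow> real) \<Rightarrow> real) \<Rightarrow> bool" where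
  "coord_Ck_on d 0 S f \<longleftrightarrow> continuous_map (subtopology (Euclidean_space d) S) euclideanreal f"
| "coord_Ck_on d (Suc k) S f \<longleftrightarrow>
     (\<forall>i<d. (\<forall>x\<in>S. (\<lambda>s. f (x(i := s))) field_differentiable (at (x i))) \<and>
            coord_Ck_on d k S (\<lambda>x. deriv (\<lambda>s. f (x(i := s))) (x i)))"

definition coord_smooth_on ::
  "nat \<Rightarrow> nat \<Rightarrow> (nat \<Rightarrow> real) set \<Rightarrow> ((nat \<Rightarrow> real) \<Rightarrow> nat \<Rightarrow> real) \<Rightarrow> bool" where
  "coord_smooth_on m d S F \<longleftrightarrow> (\<forall>j<d. \<forall>k. coord_Ck_on m k S (\<lambda>x. F x j))"

type_synonym 'g chart = "'g set \<times> ('g \<Rightarrow> nat \<Rightarrow> real)"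

definition is_chart :: "'g topology \<Rightarrow> nat \<Rightarrow> 'g chart \<Rightarrow> bool" where
  "is_chart T d = (\<lambda>(U, \<phi>). openin T U \<and> openin (Euclidean_space d) (\<phi> ` U) \<and>
     homeomorphic_map (subtopology T U) (subtopology (Euclidean_space d) (\<phi> ` U)) \<phi>)"

definition smooth_atlas :: "'g topology \<Rightarrow> nat \<Rightarrow> 'g chart set \<Rightarrow> bool" where
  "smooth_atlas T d A \<longleftrightarrow>
     (\<forall>c\<in>A. is_chart T d c) \<and> \<Union>(fst ` A) = topspace T \<and>
     (\<forall>(U, \<phi>)\<in>A. \<forall>(V, \<psi>)\<in>A. coord_smooth_on d d (\<phi> ` (U \<inter> V)) (\<lambda>p. \<psi> (inv_into U \<phi> p)))"

definition first_half :: "nat \<Rightarrow> (nat \<Rightarrow> real) \<Rightarrow> nat \<Rightarrow> real" where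
  "first_half d p = (\<lambda>i. if i < d then p i else 0)"

definition second_half :: "nat \<Rightarrow> (nat \<Rightarrow> real) \<Rightarrow> nat \<Rightarrow> real" where
  "second_half d p = (\<lambda>i. if i < d then p (d + i) else 0)"

definition smooth_mult :: "('g, 'r) monoid_scheme \<Rightarrow> nat \<Rightarrow> 'g chart set \<Rightarrow> bool" where
  "smooth_mult G d A \<longleftrightarrow>
     (\<forall>(U, \<phi>)\<in>A. \<forall>(V, \<psi>)\<in>A. \<forall>(W, \<theta>)\<in>A.
        coord_smooth_on (d + d) d
          {p \<in> topspace (Euclidean_space (d + d)).
             first_half d p \<in> \<phi> ` U \<and> second_half d p \<in> \<psi> ` V \<and>
             inv_into U \<phi> (first_half d p) \<otimes>\<^bsub>G\<^esub> inv_into V \<psi> (second_half d p) \<in> W}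
          (\<lambda>p. \<theta> (inv_into U \<phi> (first_half d p) \<otimes>\<^bsub>G\<^esub> inv_into V \<psi> (second_half d p))))"

definition smooth_inverse :: "('g, 'r) monoid_scheme \<Rightarrow> nat \<Rightarrow> 'g chart set \<Rightarrow> bool" where
  "smooth_inverse G d A \<longleftrightarrow>
     (\<forall>(U, \<phi>)\<in>A. \<forall>(V, \<psi>)\<in>A.
        coord_smooth_on d d {p \<in> \<phi> ` U. m_inv G (inv_into U \<phi> p) \<in> V}
          (\<lambda>p. \<psi> (m_inv G (inv_into U \<phi> p))))"

definition topological_group :: "('g, 'r) monoid_scheme \<Rightarrow> 'g topology \<Rightarrow> bool" where
  "topological_group G T \<longleftrightarrow> group G \<and> topspace T = carrier G \<and>
     continuous_map (prod_topology T T) T (\<lambda>(x, y). x \<otimes>\<^bsub>G\<^esub> y) \<and> continuous_map T T (m_inv G)"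

text \<open>The group G with the topology T is a Lie group of dimension d. By invariance of domain there
  is at most one such d.\<close>

definition lie_group_of_dim :: "('g, 'r) monoid_scheme \<Rightarrow> 'g topology \<Rightarrow> nat \<Rightarrow> bool" where
  "lie_group_of_dim G T d \<longleftrightarrow>
     topological_group G T \<and> Hausdorff_space T \<and> second_countable T \<and>
     (\<exists>A. smooth_atlas T d A \<and> smooth_mult G d A \<and> smooth_inverse G d A)"


section \<open>The Heisenberg group\<close>

type_synonym 'n heis = "(real ^ 'n) \<times> (real ^ 'n) \<times> real"

definition heis_mult :: "'n::finite heis \<Rightarrow> 'n heis \<Rightarrow> 'n heis" where
  "heis_mult = (\<lambda>(x, y, z) (x', y', z').
     (x + x', y + y', z + z' + 1/2 * (\<Sum>i\<in>UNIV. y $ i * x' $ i - y' $ i * x $ i)))"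

definition heis_X :: "'n::finite \<Rightarrow> 'n heis \<Rightarrow> 'n heis" where
  "heis_X i = (\<lambda>(x, y, z). (axis i 1, 0, 1/2 * y $ i))"

definition heis_Y :: "'n::finite \<Rightarrow> 'n heis \<Rightarrow> 'n heis" where
  "heis_Y i = (\<lambda>(x, y, z). (0, axis i 1, - (1/2 * x $ i)))"

definition heis_H :: "'n::finite heis \<Rightarrow> 'n heis set" where
  "heis_H q = span (range (\<lambda>i. heis_X i q) \<union> range (\<lambda>i. heis_Y i q))"

definition left_invariant :: "('n::finite heis \<Rightarrow> 'n heis \<Rightarrow> 'n heis \<Rightarrow> real) \<Rightarrow> bool" where
  "left_invariant g \<longleftrightarrow>
     (\<forall>p q. \<forall>v\<in>heis_H q. \<forall>w\<in>heis_H q.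
        g (heis_mult p q) (frechet_derivative (heis_mult p) (at q) v)
          (frechet_derivative (heis_mult p) (at q) w) = g q v w)"

end

theory Submission
  imports Defs
begin

text \<open>The metric is the constant diagonal one with entries \<open>\<gamma> k = \<plusminus>1\<close> in the frame
  \<open>(X\<^sub>i, Y\<^sub>i)\<close>. On \<open>t\<close> of the planes spanned by \<open>X\<^sub>i\<close> and \<open>Y\<^sub>i\<close> the two signs differ, on
  \<open>(l - t)/2\<close> planes both are negative, and on all others both are positive, which gives the index \<open>l\<close>.
  Measured against the symplectic form \<open>omega\<close>, the planes with equal signs carry a complex structure and
  those with different signs a paracomplex one, so that up to finite index the linear isometries form
  \<open>U(p, q) \<times> GL(t, \<real>)\<close> with \<open>p + q = n - t\<close>. This group has dimension \<open>(n - t)\<^sup>2 + t\<^sup>2\<close>, and the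
  translations add \<open>2n + 1\<close>.

  That every isometry is a translation after a linear automorphism is \<open>isometry_imp_affine_iso\<close>: an
  isometry pulls the contact form back to a multiple of itself, comparing the exterior derivative with the
  metric forces the multiple to be 1 or -1, so the vertical direction is preserved as well, and what remains
  on horizontal coordinates is an isometry of a flat pseudo-Euclidean metric, hence affine.
  Since isometries are thus affine, the compact-open topology on them is the topology of their finitely many
  coefficients (\<open>continuous_map_into_T\<close>, \<open>homeomorphic_maps_coefficients\<close>).

  Near the identity the group is charted by the translation part and the Cayley transform of the linear
  part. The Cayley transform takes the group, which is cut out by two invariant bilinear forms, to the linear
  space of matrices that are skew for both (\<open>liealg_cayley_iff\<close>); this space is
  described by the free matrix entries in \<open>lie_coords\<close>, and counting them gives the dimension
  (\<open>isometry_dim_eq\<close>). The other charts are translates of this one. In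
  these charts all group operations are rational functions without poles, and such functions are smooth because
  they are closed under partial derivatives (\<open>rational_partial_derivative\<close>).\<close>

section \<open>Algebras of real functions and matrices over them\<close>

lemma matrix_inv:
  fixes A :: "real ^ 'k::finite ^ 'k"
  assumes "det A \<noteq> 0"
  shows matrix_inv_right: "A ** matrix_inv A = mat 1" and matrix_inv_left: "matrix_inv A ** A = mat 1"
proof -
  have "\<exists>A'. A ** A' = mat 1 \<and> A' ** A = mat 1"
    using assms by (simp add: invertible_det_nz[symmetric] invertible_def)
  from someI_ex[OF this] show "A ** matrix_inv A = mat 1" "matrix_inv A ** A = mat 1"
    by (simp_all add: matrix_inv_def)
qed

text \<open>The two instances are the continuous functions on a topological space and the rational functions
  without poles on a subset of a coordinate space. Working with both at once makes one computation with
  matrix entries prove continuity in the group topology and smoothness in charts.\<close>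
locale function_algebra =
  fixes S :: "'x set" and \<A> :: "('x \<Rightarrow> real) set"
  assumes const: "(\<lambda>x. c) \<in> \<A>"
    and add: "f \<in> \<A> \<Longrightarrow> g \<in> \<A> \<Longrightarrow> (\<lambda>x. f x + g x) \<in> \<A>"
    and mult: "f \<in> \<A> \<Longrightarrow> g \<in> \<A> \<Longrightarrow> (\<lambda>x. f x * g x) \<in> \<A>"
    and inverse: "f \<in> \<A> \<Longrightarrow> (\<And>x. x \<in> S \<Longrightarrow> f x \<noteq> 0) \<Longrightarrow> (\<lambda>x. inverse (f x)) \<in> \<A>"
    and cong: "f \<in> \<A> \<Longrightarrow> (\<And>x. x \<in> S \<Longrightarrow> g x = f x) \<Longrightarrow> g \<in> \<A>"
begin

lemma uminus: "f \<in> \<A> \<Longrightarrow> (\<lambda>x. - f x) \<in> \<A>"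
  using mult[OF const[of "-1"], of f] by simp

lemma diff: "f \<in> \<A> \<Longrightarrow> g \<in> \<A> \<Longrightarrow> (\<lambda>x. f x - g x) \<in> \<A>"
  using add[OF _ uminus, of f g] by simp

lemma divide: "f \<in> \<A> \<Longrightarrow> g \<in> \<A> \<Longrightarrow> (\<And>x. x \<in> S \<Longrightarrow> g x \<noteq> 0) \<Longrightarrow> (\<lambda>x. f x / g x) \<in> \<A>"
  using mult[OF _ inverse, of f g] by (simp add: field_simps)

lemma sum: "(\<And>i. i \<in> I \<Longrightarrow> f i \<in> \<A>) \<Longrightarrow> (\<lambda>x. \<Sum>i\<in>I. f i x) \<in> \<A>"
  by (induction I rule: infinite_finite_induct) (auto intro: const add)

lemma prod: "(\<And>i. i \<in> I \<Longrightarrow> f i \<in> \<A>) \<Longrightarrow> (\<lambda>x. \<Prod>i\<in>I. f i x) \<in> \<A>"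
  by (induction I rule: infinite_finite_induct) (auto intro: const mult)

definition vec_in :: "('x \<Rightarrow> real ^ 'k::finite) \<Rightarrow> bool" where
  "vec_in v \<longleftrightarrow> (\<forall>k. (\<lambda>x. v x $ k) \<in> \<A>)"

definition mat_in :: "('x \<Rightarrow> real ^ 'k::finite ^ 'j::finite) \<Rightarrow> bool" where
  "mat_in A \<longleftrightarrow> (\<forall>j k. (\<lambda>x. A x $ j $ k) \<in> \<A>)"

lemma vec_add: "vec_in u \<Longrightarrow> vec_in v \<Longrightarrow> vec_in (\<lambda>x. u x + v x)"
  and vec_uminus: "vec_in v \<Longrightarrow> vec_in (\<lambda>x. - v x)"
  and mat_const: "mat_in (\<lambda>x. C)"
  and mat_add: "mat_in A \<Longrightarrow> mat_in B \<Longrightarrow> mat_in (\<lambda>x. A x + B x)"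
  and mat_diff: "mat_in A \<Longrightarrow> mat_in B \<Longrightarrow> mat_in (\<lambda>x. A x - B x)"
  by (auto simp: vec_in_def mat_in_def intro: add uminus diff const)

lemma mat_mult: "mat_in A \<Longrightarrow> mat_in B \<Longrightarrow> mat_in (\<lambda>x. A x ** B x)"
  by (auto simp: mat_in_def matrix_matrix_mult_def intro!: sum mult)

lemma mat_vec_mult: "mat_in A \<Longrightarrow> vec_in v \<Longrightarrow> vec_in (\<lambda>x. A x *v v x)"
  by (auto simp: mat_in_def vec_in_def matrix_vector_mult_def intro!: sum mult)

lemma det: "mat_in A \<Longrightarrow> (\<lambda>x. det (A x)) \<in> \<A>"
  unfolding det_def by (auto simp: mat_in_def intro!: sum mult prod const)

text \<open>Cramer's rule writes the entries of the inverse as quotients of determinants.\<close>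
lemma mat_inv:
  fixes A :: "'x \<Rightarrow> real ^ 'k::finite ^ 'k"
  assumes A: "mat_in A" and nz: "\<And>x. x \<in> S \<Longrightarrow> det (A x) \<noteq> 0"
  shows "mat_in (\<lambda>x. matrix_inv (A x))"
  unfolding mat_in_def
proof (intro allI)
  fix i j :: 'k
  let ?C = "\<lambda>x. (\<chi> k l. if l = i then axis j 1 $ k else A x $ k $ l) :: real ^ 'k ^ 'k"
  have "mat_in ?C"
    unfolding mat_in_def
  proof (intro allI)
    show "(\<lambda>x. ?C x $ k $ l) \<in> \<A>" for k l
      using A const[of "axis j 1 $ k"] by (cases "l = i") (auto simp: mat_in_def)
  qed
  then have "(\<lambda>x. det (?C x) / det (A x)) \<in> \<A>"
    using A nz by (intro divide det)
  moreover have "matrix_inv (A x) $ i $ j = det (?C x) / det (A x)" if "x \<in> S" for x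
  proof -
    have "A x *v (matrix_inv (A x) *v axis j 1) = axis j 1"
      by (simp add: matrix_vector_mul_assoc matrix_inv_right[OF nz[OF that]])
    then have "matrix_inv (A x) *v axis j 1 =
        (\<chi> k. det (\<chi> i l. if l = k then axis j 1 $ i else A x $ i $ l) / det (A x))"
      using cramer[OF nz[OF that]] by blast
    then have "(matrix_inv (A x) *v axis j 1) $ i = det (?C x) / det (A x)"
      by simp
    then show ?thesis
      by (simp add: matrix_vector_mult_basis column_def)
  qed
  ultimately show "(\<lambda>x. matrix_inv (A x) $ i $ j) \<in> \<A>"
    by (rule cong)
qed

end

lemma function_algebra_continuous_map:
  "function_algebra (topspace T) {f. continuous_map T euclideanreal f}"
proof
  fix f g assume "f \<in> {f. continuous_map T euclideanreal f}" "\<And>x. x \<in> topspace T \<Longrightarrow> g x = f x"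
  then show "g \<in> {f. continuous_map T euclideanreal f}"
    using continuous_map_eq[of T euclideanreal f g] by auto
qed (auto intro: continuous_map_add continuous_map_real_mult continuous_map_real_inverse)

section \<open>Rational functions are smooth\<close>

text \<open>The rule \<open>cong\<close> makes only the values on \<open>S\<close> matter: a group operation is given by a rational
  formula only at those points where the chart maps involved are meaningful.\<close>
inductive rational_on :: "nat \<Rightarrow> (nat \<Rightarrow> real) set \<Rightarrow> ((nat \<Rightarrow> real) \<Rightarrow> real) \<Rightarrow> bool"
  for m :: nat and S :: "(nat \<Rightarrow> real) set" where
  const: "rational_on m S (\<lambda>x. c)"
| coord: "i < m \<Longrightarrow> rational_on m S (\<lambda>x. x i)"
| add: "rational_on m S f \<Longrightarrow> rational_on m S g \<Longrightarrow> rational_on m S (\<lambda>x. f x + g x)"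
| mult: "rational_on m S f \<Longrightarrow> rational_on m S g \<Longrightarrow> rational_on m S (\<lambda>x. f x * g x)"
| inverse: "rational_on m S f \<Longrightarrow> (\<And>x. x \<in> S \<Longrightarrow> f x \<noteq> 0) \<Longrightarrow> rational_on m S (\<lambda>x. inverse (f x))"
| cong: "rational_on m S f \<Longrightarrow> (\<And>x. x \<in> S \<Longrightarrow> g x = f x) \<Longrightarrow> rational_on m S g"

lemma function_algebra_rational: "function_algebra S {f. rational_on m S f}"
  by unfold_locales (auto intro: rational_on.intros)

lemma rational_subset: "rational_on m S f \<Longrightarrow> S' \<subseteq> S \<Longrightarrow> rational_on m S' f"
  by (induction rule: rational_on.induct) (auto intro: rational_on.intros)

lemma rational_continuous:
  assumes "rational_on m S f"
  shows "continuous_map (subtopology (Euclidean_space m) S) euclideanreal f"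
  using assms
proof induction
  case (coord i)
  show ?case
    unfolding Euclidean_space_def
    by (intro continuous_map_from_subtopology continuous_map_product_projection) auto
next
  case (cong f g)
  then show ?case
    by (auto intro: continuous_map_eq)
qed (auto intro: continuous_map_add continuous_map_real_mult continuous_map_real_inverse)

lemma continuous_map_update:
  assumes "x \<in> topspace (Euclidean_space m)" "i < m"
  shows "continuous_map euclideanreal (Euclidean_space m) (\<lambda>s. x(i := s))"
proof -
  have "x(i := s) = (\<lambda>j. if j < m then (if j = i then s else x j) else 0)" for s
    using assms by (auto simp: topspace_Euclidean_space)
  moreover have "continuous_map euclideanreal euclideanreal (\<lambda>s. if j = i then s else x j)" for j
    by (cases "j = i") auto
  ultimately show ?thesis
    by (simp only: continuous_map_componentwise_Euclidean_space) simp
qed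

lemma eventually_update_in_open:
  assumes S: "openin (Euclidean_space m) S" and x: "x \<in> S" and i: "i < m"
  shows "eventually (\<lambda>s. x(i := s) \<in> S) (nhds (x i))"
proof -
  have x': "x \<in> topspace (Euclidean_space m)"
    using S x openin_subset by blast
  have "open {s \<in> topspace euclideanreal. x(i := s) \<in> S}"
    using openin_continuous_map_preimage[OF continuous_map_update[OF x' i] S] by simp
  moreover have "x i \<in> {s \<in> topspace euclideanreal. x(i := s) \<in> S}"
    using x by simp
  ultimately show ?thesis
    unfolding eventually_nhds by blast
qed

text \<open>The quotient rule stays within the class, and an open set contains a piece of every coordinate line
  through its points, so that values outside it do not enter. By induction on the order this makes rational
  functions smooth.\<close>
lemma rational_partial_derivative:
  assumes f: "rational_on m S f" and S: "openin (Euclidean_space m) S" and i: "i < m"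
  shows "\<exists>f'. rational_on m S f' \<and>
    (\<forall>x\<in>S. ((\<lambda>s. f (x(i := s))) has_field_derivative f' x) (at (x i)))"
  using f
proof induction
  case (const c)
  show ?case
    by (intro exI[of _ "\<lambda>x. 0"]) (auto intro: rational_on.const)
next
  case (coord j)
  show ?case
    by (cases "j = i") (auto intro!: exI[of _ "\<lambda>x. if j = i then 1 else 0"] rational_on.const)
next
  case (add f g)
  then obtain f' g' where
    f': "rational_on m S f'" "\<forall>x\<in>S. ((\<lambda>s. f (x(i := s))) has_field_derivative f' x) (at (x i))" and
    g': "rational_on m S g'" "\<forall>x\<in>S. ((\<lambda>s. g (x(i := s))) has_field_derivative g' x) (at (x i))"
    by blast
  then show ?case
    by (intro exI[of _ "\<lambda>x. f' x + g' x"]) (auto intro: rational_on.add DERIV_add simp del: fun_upd_apply)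
next
  case (mult f g)
  then obtain f' g' where
    f': "rational_on m S f'" "\<forall>x\<in>S. ((\<lambda>s. f (x(i := s))) has_field_derivative f' x) (at (x i))" and
    g': "rational_on m S g'" "\<forall>x\<in>S. ((\<lambda>s. g (x(i := s))) has_field_derivative g' x) (at (x i))"
    by blast
  show ?case
  proof (intro exI conjI ballI)
    show "rational_on m S (\<lambda>x. f' x * g x + g' x * f x)"
      using f' g' mult by (intro rational_on.add rational_on.mult)
    show "((\<lambda>s. f (x(i := s)) * g (x(i := s))) has_field_derivative f' x * g x + g' x * f x)
        (at (x i))" if "x \<in> S" for x
      using DERIV_mult[OF f'(2)[rule_format, OF that] g'(2)[rule_format, OF that]] by simp
  qed
next
  case (inverse f)
  then obtain f' where
    f': "rational_on m S f'" "\<forall>x\<in>S. ((\<lambda>s. f (x(i := s))) has_field_derivative f' x) (at (x i))"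
    by blast
  show ?case
  proof (intro exI conjI ballI)
    show "rational_on m S (\<lambda>x. - 1 * (inverse (f x) * f' x * inverse (f x)))"
      using f' inverse by (intro rational_on.mult rational_on.inverse rational_on.const)
    show "((\<lambda>s. inverse (f (x(i := s)))) has_field_derivative
        - 1 * (inverse (f x) * f' x * inverse (f x))) (at (x i))" if "x \<in> S" for x
      using DERIV_inverse'[OF f'(2)[rule_format, OF that]] inverse(2)[OF that] by simp
  qed
next
  case (cong f g)
  then obtain f' where
    f': "rational_on m S f'" "\<forall>x\<in>S. ((\<lambda>s. f (x(i := s))) has_field_derivative f' x) (at (x i))"
    by blast
  have "((\<lambda>s. g (x(i := s))) has_field_derivative f' x) (at (x i))" if x: "x \<in> S" for x
  proof -
    have "eventually (\<lambda>s. g (x(i := s)) = f (x(i := s))) (nhds (x i))"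
      using eventually_update_in_open[OF S x i] by eventually_elim (rule cong(2))
    then show ?thesis
      using f'(2) x by (subst DERIV_cong_ev[OF refl _ refl]) auto
  qed
  then show ?case
    using f' by blast
qed

lemma rational_imp_coord_Ck_on:
  assumes "rational_on m S f" and S: "openin (Euclidean_space m) S"
  shows "coord_Ck_on m k S f"
  using assms(1)
proof (induction k arbitrary: f)
  case 0
  then show ?case
    by (simp add: rational_continuous)
next
  case (Suc k)
  show ?case
    unfolding coord_Ck_on.simps
  proof (intro allI impI conjI)
    fix i assume i: "i < m"
    obtain f' where f': "rational_on m S f'"
      "\<forall>x\<in>S. ((\<lambda>s. f (x(i := s))) has_field_derivative f' x) (at (x i))"
      using rational_partial_derivative[OF Suc.prems S i] by blast
    then show "\<forall>x\<in>S. (\<lambda>s. f (x(i := s))) field_differentiable at (x i)"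
      by (auto simp: field_differentiable_def)
    have "rational_on m S (\<lambda>x. deriv (\<lambda>s. f (x(i := s))) (x i))"
      using f' by (elim rational_on.cong) (auto intro: DERIV_imp_deriv)
    then show "coord_Ck_on m k S (\<lambda>x. deriv (\<lambda>s. f (x(i := s))) (x i))"
      by (rule Suc.IH)
  qed
qed

section \<open>Smooth maps and symmetry of second derivatives\<close>

text \<open>Two applications of the mean value theorem, first in direction \<open>a\<close> and then in direction \<open>b\<close>. The
  second difference is symmetric in \<open>a\<close> and \<open>b\<close>, so letting the step tend to 0 identifies the two mixed
  derivatives.\<close>
lemma second_difference_mean_value:
  fixes f :: "'a::real_normed_vector \<Rightarrow> real"
  assumes f: "\<And>x. (f has_derivative f' x) (at x)"
    and g: "\<And>x. ((\<lambda>y. f' y a) has_derivative g x) (at x)"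
    and h: "0 < h"
  shows "\<exists>s\<in>{0..h}. \<exists>t\<in>{0..h}. f (x + h *\<^sub>R a + h *\<^sub>R b) - f (x + h *\<^sub>R a) - f (x + h *\<^sub>R b) + f x
    = h * (h * g (x + s *\<^sub>R a + t *\<^sub>R b) b)"
proof -
  define \<phi> where "\<phi> s = f (x + s *\<^sub>R a + h *\<^sub>R b) - f (x + s *\<^sub>R a)" for s
  have \<phi>: "(\<phi> has_real_derivative f' (x + s *\<^sub>R a + h *\<^sub>R b) a - f' (x + s *\<^sub>R a) a) (at s)" for s
  proof -
    have *: "((\<lambda>s. f (x + s *\<^sub>R a + c)) has_derivative (\<lambda>r. f' (x + s *\<^sub>R a + c) (r *\<^sub>R a))) (at s)" for c
      by (rule has_derivative_compose[OF _ f]) (auto intro!: derivative_eq_intros)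
    have "linear (f' y)" for y
      using f has_derivative_linear by blast
    then have "(\<lambda>r. f' y (r *\<^sub>R a)) = (*) (f' y a)" for y
      by (auto simp: linear_scale)
    then show ?thesis
      using has_derivative_diff[OF *[of "h *\<^sub>R b"] *[of 0]]
      by (simp add: \<phi>_def[abs_def] has_field_derivative_def fun_eq_iff left_diff_distrib[symmetric]
          fun_cong[OF \<open>\<And>y. (\<lambda>r. f' y (r *\<^sub>R a)) = (*) (f' y a)\<close>])
  qed
  obtain s where s: "0 < s" "s < h" "\<phi> h - \<phi> 0 = h * (f' (x + s *\<^sub>R a + h *\<^sub>R b) a - f' (x + s *\<^sub>R a) a)"
    using MVT2[OF h \<phi>] by auto
  define \<psi> where "\<psi> t = f' (x + s *\<^sub>R a + t *\<^sub>R b) a" for t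
  have \<psi>: "(\<psi> has_real_derivative g (x + s *\<^sub>R a + t *\<^sub>R b) b) (at t)" for t
  proof -
    have *: "(\<psi> has_derivative (\<lambda>r. g (x + s *\<^sub>R a + t *\<^sub>R b) (r *\<^sub>R b))) (at t)"
      unfolding \<psi>_def
      by (rule has_derivative_compose[OF _ g]) (auto intro!: derivative_eq_intros)
    have "linear (g y)" for y
      using g has_derivative_linear by blast
    then have "(\<lambda>r. g y (r *\<^sub>R b)) = (*) (g y b)" for y
      by (auto simp: linear_scale)
    then show ?thesis
      using * by (simp add: has_field_derivative_def)
  qed
  obtain t where t: "0 < t" "t < h" "\<psi> h - \<psi> 0 = h * g (x + s *\<^sub>R a + t *\<^sub>R b) b"
    using MVT2[OF h \<psi>] by auto
  show ?thesis
    using s t by (intro bexI[of _ s] bexI[of _ t]) (auto simp: \<phi>_def \<psi>_def)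
qed

lemma symmetric_second_derivative_real:
  fixes f :: "'a::real_normed_vector \<Rightarrow> real"
  assumes f: "\<And>x. (f has_derivative f' x) (at x)"
    and ga: "\<And>x. ((\<lambda>y. f' y a) has_derivative ga x) (at x)"
    and gb: "\<And>x. ((\<lambda>y. f' y b) has_derivative gb x) (at x)"
    and ca: "isCont (\<lambda>x. ga x b) x" and cb: "isCont (\<lambda>x. gb x a) x"
  shows "ga x b = gb x a"
proof -
  define h :: "nat \<Rightarrow> real" where "h n = inverse (real (Suc n))" for n
  have h: "h n > 0" for n
    by (simp add: h_def)
  have "\<exists>s t s' t'. s \<in> {0..h n} \<and> t \<in> {0..h n} \<and> s' \<in> {0..h n} \<and> t' \<in> {0..h n} \<and>
     ga (x + s *\<^sub>R a + t *\<^sub>R b) b = gb (x + s' *\<^sub>R b + t' *\<^sub>R a) a" for n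
  proof -
    obtain s t where 1: "s \<in> {0..h n}" "t \<in> {0..h n}"
      "f (x + h n *\<^sub>R a + h n *\<^sub>R b) - f (x + h n *\<^sub>R a) - f (x + h n *\<^sub>R b) + f x
        = h n * (h n * ga (x + s *\<^sub>R a + t *\<^sub>R b) b)"
      using second_difference_mean_value[OF f ga h] by blast
    obtain s' t' where 2: "s' \<in> {0..h n}" "t' \<in> {0..h n}"
      "f (x + h n *\<^sub>R b + h n *\<^sub>R a) - f (x + h n *\<^sub>R b) - f (x + h n *\<^sub>R a) + f x
        = h n * (h n * gb (x + s' *\<^sub>R b + t' *\<^sub>R a) a)"
      using second_difference_mean_value[OF f gb h] by blast
    have "h n * (h n * ga (x + s *\<^sub>R a + t *\<^sub>R b) b) = h n * (h n * gb (x + s' *\<^sub>R b + t' *\<^sub>R a) a)"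
      unfolding 1(3)[symmetric] 2(3)[symmetric] by (simp add: algebra_simps)
    then have "ga (x + s *\<^sub>R a + t *\<^sub>R b) b = gb (x + s' *\<^sub>R b + t' *\<^sub>R a) a"
      using h[of n] by simp
    then show ?thesis
      using 1 2 by blast
  qed
  then obtain s t s' t' where st: "\<And>n. s n \<in> {0..h n}" "\<And>n. t n \<in> {0..h n}"
    "\<And>n. s' n \<in> {0..h n}" "\<And>n. t' n \<in> {0..h n}"
    and eq: "\<And>n. ga (x + s n *\<^sub>R a + t n *\<^sub>R b) b = gb (x + s' n *\<^sub>R b + t' n *\<^sub>R a) a"
    by metis
  have h0: "h \<longlonglongrightarrow> 0"
    unfolding h_def by (rule LIMSEQ_inverse_real_of_nat)
  have to0: "r \<longlonglongrightarrow> 0" if "\<And>n. r n \<in> {0..h n}" for r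
    by (rule tendsto_sandwich[OF _ _ tendsto_const h0]) (use that in auto)
  have "(\<lambda>n. x + s n *\<^sub>R a + t n *\<^sub>R b) \<longlonglongrightarrow> x + 0 *\<^sub>R a + 0 *\<^sub>R b"
    by (intro tendsto_intros to0 st)
  then have "(\<lambda>n. ga (x + s n *\<^sub>R a + t n *\<^sub>R b) b) \<longlonglongrightarrow> ga x b"
    using isCont_tendsto_compose[OF ca] by simp
  moreover have "(\<lambda>n. x + s' n *\<^sub>R b + t' n *\<^sub>R a) \<longlonglongrightarrow> x + 0 *\<^sub>R b + 0 *\<^sub>R a"
    by (intro tendsto_intros to0 st)
  then have "(\<lambda>n. gb (x + s' n *\<^sub>R b + t' n *\<^sub>R a) a) \<longlonglongrightarrow> gb x a"
    using isCont_tendsto_compose[OF cb] by simp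
  ultimately show ?thesis
    by (simp add: eq LIMSEQ_unique)
qed

abbreviation "\<DD> f x \<equiv> frechet_derivative f (at x)"

lemma smooth_differentiable: "smooth f \<Longrightarrow> f differentiable (at x)"
  unfolding smooth_def by (drule spec[of _ "Suc 0"]) simp

lemma smooth_has_derivative: "smooth f \<Longrightarrow> (f has_derivative \<DD> f x) (at x)"
  using smooth_differentiable frechet_derivative_works by blast

lemma smooth_derivative: "smooth f \<Longrightarrow> smooth (\<lambda>x. \<DD> f x v)"
  unfolding smooth_def by (metis Ck_on.simps(2))

lemma smooth_isCont: "smooth f \<Longrightarrow> isCont f x"
  using smooth_has_derivative has_derivative_continuous by blast

lemma linear_frechet_derivative: "smooth f \<Longrightarrow> linear (\<DD> f x)"
  using smooth_has_derivative has_derivative_linear by blast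

lemma smooth_second_derivative_commute:
  assumes f: "smooth f"
  shows "\<DD> (\<lambda>y. \<DD> f y a) x b = \<DD> (\<lambda>y. \<DD> f y b) x a"
proof (rule euclidean_eqI)
  fix e :: 'b assume "e \<in> Basis"
  note d = has_derivative_inner_left[OF smooth_has_derivative]
  show "\<DD> (\<lambda>y. \<DD> f y a) x b \<bullet> e = \<DD> (\<lambda>y. \<DD> f y b) x a \<bullet> e"
    by (rule symmetric_second_derivative_real[of "\<lambda>x. f x \<bullet> e" "\<lambda>x v. \<DD> f x v \<bullet> e"])
      (intro d f smooth_derivative isCont_inner continuous_const smooth_isCont)+
qed

lemma smoothI:
  assumes "\<And>x. (f has_derivative f' x) (at x)" and "\<And>v k. Ck_on k UNIV (\<lambda>x. f' x v)"
  shows "smooth f"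
proof -
  have "\<DD> f x = f' x" for x
    using assms(1) frechet_derivative_at by metis
  then have "Ck_on (Suc k) UNIV f" for k
    using assms by (auto simp: differentiable_def)
  moreover have "Ck_on 0 UNIV f"
    using assms(1) by (auto intro!: continuous_at_imp_continuous_on has_derivative_continuous)
  ultimately show ?thesis
    unfolding smooth_def by (metis not0_implies_Suc)
qed

lemma smooth_const: "smooth (\<lambda>x. c)"
proof -
  have "Ck_on k UNIV (\<lambda>x::'a. c::'b)" for k c
    by (induction k arbitrary: c) (auto simp: )
  then show ?thesis
    by (simp add: smooth_def)
qed

lemma smooth_affine: "linear L \<Longrightarrow> smooth (\<lambda>x. c + L x)"
  by (rule smoothI[of _ "\<lambda>x. L"])
    (auto intro!: derivative_eq_intros linear_imp_has_derivative smooth_const[unfolded smooth_def, rule_format])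

lemma Ck_on_add:
  "Ck_on k UNIV f \<Longrightarrow> Ck_on k UNIV g \<Longrightarrow> Ck_on k UNIV (\<lambda>x. f x + g x)"
proof (induction k arbitrary: f g)
  case 0
  then show ?case
    by (simp add: continuous_on_add)
next
  case (Suc k)
  then have "\<DD> (\<lambda>x. f x + g x) x = (\<lambda>v. \<DD> f x v + \<DD> g x v)" for x
    by (intro frechet_derivative_at[symmetric] has_derivative_add)
      (auto simp: frechet_derivative_works)
  then show ?case
    using Suc by (auto intro: differentiable_add)
qed

text \<open>The Leibniz rule expresses the derivative by the same \<open>\<beta>\<close>, applied to pairs of smooth functions
  again; hence the induction over the order runs over all \<open>f\<close> and \<open>g\<close> at once.\<close>
lemma smooth_bounded_bilinear:
  fixes \<beta> :: "'a::euclidean_space \<Rightarrow> 'b::euclidean_space \<Rightarrow> 'c::euclidean_space"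
    and f :: "'d::euclidean_space \<Rightarrow> 'a"
  assumes \<beta>: "bounded_bilinear \<beta>" and "smooth f" "smooth g"
  shows "smooth (\<lambda>x. \<beta> (f x) (g x))"
proof -
  have "Ck_on k UNIV (\<lambda>x. \<beta> (f x) (g x))" for k
    using assms(2,3)
  proof (induction k arbitrary: f g)
    case 0
    then have "isCont (\<lambda>x. \<beta> (f x) (g x)) x" for x
      by (intro bounded_bilinear.continuous[OF \<beta>] smooth_isCont)
    then show ?case
      by (auto intro!: continuous_at_imp_continuous_on)
  next
    case (Suc k)
    have d: "((\<lambda>x. \<beta> (f x) (g x)) has_derivative (\<lambda>v. \<beta> (f x) (\<DD> g x v) + \<beta> (\<DD> f x v) (g x))) (at x)" for x
      by (intro bounded_bilinear.FDERIV[OF \<beta>] smooth_has_derivative Suc.prems)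
    have "\<DD> (\<lambda>x. \<beta> (f x) (g x)) x = (\<lambda>v. \<beta> (f x) (\<DD> g x v) + \<beta> (\<DD> f x v) (g x))" for x
      using frechet_derivative_at[OF d] by simp
    moreover have "Ck_on k UNIV (\<lambda>x. \<beta> (f x) (\<DD> g x v) + \<beta> (\<DD> f x v) (g x))" for v
      by (intro Ck_on_add Suc.IH smooth_derivative Suc.prems)
    ultimately show ?case
      using d by (auto simp: differentiable_def)
  qed
  then show ?thesis
    unfolding smooth_def by blast
qed

section \<open>The Heisenberg group in horizontal and vertical coordinates\<close>

definition hcoord :: "'n::finite heis \<Rightarrow> real ^ ('n + 'n)" where
  "hcoord q = (\<chi> k. case k of Inl i \<Rightarrow> fst q $ i | Inr i \<Rightarrow> fst (snd q) $ i)"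

definition vcoord :: "'n::finite heis \<Rightarrow> real" where
  "vcoord q = snd (snd q)"

definition heis_of :: "real ^ ('n + 'n) \<Rightarrow> real \<Rightarrow> 'n::finite heis" where
  "heis_of v z = ((\<chi> i. v $ Inl i), (\<chi> i. v $ Inr i), z)"

text \<open>The symplectic form on the horizontal space: half of it is the cocycle of the group law,
  and up to sign it is the exterior derivative of the contact form on horizontal vectors.\<close>
definition omega :: "real ^ ('n + 'n) \<Rightarrow> real ^ ('n::finite + 'n) \<Rightarrow> real" where
  "omega u v = (\<Sum>i\<in>UNIV. u $ Inr i * v $ Inl i - v $ Inr i * u $ Inl i)"

text \<open>The left-invariant horizontal vector field with constant coefficients \<open>v\<close>, evaluated at \<open>q\<close>.\<close>
definition hlift :: "'n::finite heis \<Rightarrow> real ^ ('n + 'n) \<Rightarrow> 'n heis" where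
  "hlift q v = heis_of v (omega (hcoord q) v / 2)"

lemma hcoord_heis_of [simp]: "hcoord (heis_of v z) = v"
  by (auto simp: hcoord_def heis_of_def vec_eq_iff split: sum.split)

lemma vcoord_heis_of [simp]: "vcoord (heis_of v z) = z"
  by (simp add: vcoord_def heis_of_def)

lemma heis_of_hcoord_vcoord [simp]: "heis_of (hcoord q) (vcoord q) = q"
  by (simp add: heis_of_def hcoord_def vcoord_def)

lemma heis_eq_iff: "p = q \<longleftrightarrow> hcoord p = hcoord q \<and> vcoord p = vcoord q"
  by (metis heis_of_hcoord_vcoord)

lemma linear_hcoord: "linear hcoord" and linear_vcoord: "linear vcoord"
  by (auto intro!: linearI simp: hcoord_def vcoord_def vec_eq_iff split: sum.split)

lemmas hcoord_simps [simp] = linear_add[OF linear_hcoord] linear_diff[OF linear_hcoord] linear_0[OF linear_hcoord]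
  linear_cmul[OF linear_hcoord] linear_neg[OF linear_hcoord]
lemmas vcoord_simps [simp] = linear_add[OF linear_vcoord] linear_diff[OF linear_vcoord] linear_0[OF linear_vcoord]
  linear_cmul[OF linear_vcoord] linear_neg[OF linear_vcoord]

lemmas hcoord_has_derivative = bounded_linear.has_derivative[OF linear_conv_bounded_linear[THEN iffD1, OF linear_hcoord]]
lemmas vcoord_has_derivative = bounded_linear.has_derivative[OF linear_conv_bounded_linear[THEN iffD1, OF linear_vcoord]]

lemma bilinear_omega: "bilinear omega"
  unfolding bilinear_def omega_def
  by (auto intro!: linearI simp: algebra_simps sum.distrib sum_subtractf sum_distrib_left)

lemma bounded_bilinear_omega: "bounded_bilinear omega"
  using bilinear_omega bilinear_conv_bounded_bilinear by blast

lemmas omega_simps [simp] = bilinear_ladd[OF bilinear_omega] bilinear_radd[OF bilinear_omega]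
  bilinear_lsub[OF bilinear_omega] bilinear_rsub[OF bilinear_omega]
  bilinear_lneg[OF bilinear_omega] bilinear_rneg[OF bilinear_omega]
  bilinear_lmul[OF bilinear_omega] bilinear_rmul[OF bilinear_omega]
  bilinear_lzero[OF bilinear_omega] bilinear_rzero[OF bilinear_omega]

lemmas omega_has_derivative = bounded_bilinear.FDERIV[OF bounded_bilinear_omega]

lemma omega_commute: "omega u v = - omega v u"
  by (simp add: omega_def sum_negf[symmetric])

lemma omega_self [simp]: "omega u u = 0"
  using omega_commute[of u u] by simp

lemma omega_axis: "omega u (axis (Inl i) 1) = u $ Inr i" "omega u (axis (Inr i) 1) = - u $ Inl i"
proof -
  have "omega u (axis (Inl i) 1) = (\<Sum>j\<in>UNIV. if j = i then u $ Inr j else 0)"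
    unfolding omega_def by (intro sum.cong refl) (auto simp: axis_def)
  then show "omega u (axis (Inl i) 1) = u $ Inr i" by simp
  have "omega u (axis (Inr i) 1) = (\<Sum>j\<in>UNIV. if j = i then - u $ Inl j else 0)"
    unfolding omega_def by (intro sum.cong refl) (auto simp: axis_def)
  then show "omega u (axis (Inr i) 1) = - u $ Inl i" by simp
qed

lemma omega_nondegenerate: "(\<And>v. omega u v = 0) \<Longrightarrow> u = 0"
  unfolding vec_eq_iff
proof
  fix k assume "\<And>v. omega u v = 0"
  then show "u $ k = 0 $ k"
    using omega_axis[of u] by (cases k) auto
qed

lemma heis_mult_eq: "heis_mult p q = heis_of (hcoord p + hcoord q) (vcoord p + vcoord q + omega (hcoord p) (hcoord q) / 2)"
  by (auto simp: heis_mult_def heis_of_def hcoord_def vcoord_def omega_def vec_eq_iff split: prod.split)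

lemma linear_hlift: "linear (hlift q)"
  by (rule linearI) (simp_all add: hlift_def heis_eq_iff field_simps)

lemma heis_X_eq: "heis_X i q = hlift q (axis (Inl i) 1)"
  and heis_Y_eq: "heis_Y i q = hlift q (axis (Inr i) 1)"
proof -
  have "hcoord (heis_X i q) = axis (Inl i) 1" "hcoord (heis_Y i q) = axis (Inr i) 1"
    by (auto simp: heis_X_def heis_Y_def hcoord_def axis_def vec_eq_iff split: prod.split sum.split)
  moreover have "vcoord (heis_X i q) = hcoord q $ Inr i / 2" "vcoord (heis_Y i q) = - hcoord q $ Inl i / 2"
    by (auto simp: heis_X_def heis_Y_def hcoord_def vcoord_def split: prod.split)
  ultimately show "heis_X i q = hlift q (axis (Inl i) 1)" "heis_Y i q = hlift q (axis (Inr i) 1)"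
    by (simp_all add: heis_eq_iff hlift_def omega_axis)
qed

lemma heis_H_eq: "heis_H (q :: 'n::finite heis) = range (hlift q)"
proof -
  have "range (\<lambda>i. heis_X i q) \<union> range (\<lambda>i. heis_Y i q) = hlift q ` (range (\<lambda>k. axis k 1))"
    unfolding image_Un[symmetric] image_image heis_X_eq heis_Y_eq UNIV_sum
    by (simp add: image_Un image_image)
  moreover have "span (range (\<lambda>k. axis k 1)) = (UNIV :: (real ^ ('n + 'n)) set)"
    using span_Basis[where 'a = "real ^ ('n + 'n)"] by (simp add: Basis_vec_def UNION_singleton_eq_range)
  ultimately show ?thesis
    unfolding heis_H_def by (simp add: linear_span_image[OF linear_hlift])
qed

definition contact_form :: "'n::finite heis \<Rightarrow> 'n heis \<Rightarrow> real" where
  "contact_form q a = vcoord a - omega (hcoord q) (hcoord a) / 2"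

lemma heis_H_iff_contact_form: "a \<in> heis_H q \<longleftrightarrow> contact_form q a = 0"
  unfolding heis_H_eq contact_form_def hlift_def by (auto simp: heis_eq_iff)

lemma linear_contact_form: "linear (contact_form q)"
  by (rule linearI) (simp_all add: contact_form_def field_simps)

section \<open>Diagonal metrics and the shape of their isometries\<close>

locale heis_metric =
  fixes \<gamma> :: "'n::finite + 'n \<Rightarrow> real"
  assumes \<gamma>: "\<gamma> k = 1 \<or> \<gamma> k = -1"
begin

definition G :: "real ^ ('n + 'n) \<Rightarrow> real ^ ('n + 'n) \<Rightarrow> real" where
  "G u v = (\<Sum>k\<in>UNIV. \<gamma> k * u $ k * v $ k)"

definition diag_metric :: "'n heis \<Rightarrow> 'n heis \<Rightarrow> 'n heis \<Rightarrow> real" where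
  "diag_metric q v w = G (hcoord v) (hcoord w)"

lemma \<gamma>_sq [simp]: "\<gamma> k * \<gamma> k = 1" "\<gamma> k * (\<gamma> k * x) = x"
  using \<gamma>[of k] by auto

lemma bilinear_G: "bilinear G"
  unfolding bilinear_def G_def
  by (auto intro!: linearI simp: algebra_simps sum.distrib sum_distrib_left)

lemma bounded_bilinear_G: "bounded_bilinear G"
  using bilinear_G bilinear_conv_bounded_bilinear by blast

lemmas G_simps [simp] = bilinear_ladd[OF bilinear_G] bilinear_radd[OF bilinear_G]
  bilinear_lsub[OF bilinear_G] bilinear_rsub[OF bilinear_G]
  bilinear_lneg[OF bilinear_G] bilinear_rneg[OF bilinear_G]
  bilinear_lmul[OF bilinear_G] bilinear_rmul[OF bilinear_G]
  bilinear_lzero[OF bilinear_G] bilinear_rzero[OF bilinear_G]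

lemmas G_has_derivative = bounded_bilinear.FDERIV[OF bounded_bilinear_G]

lemma G_commute: "G u v = G v u"
  by (simp add: G_def mult_ac)

lemma G_axis: "G u (axis k 1) = \<gamma> k * u $ k"
proof -
  have "G u (axis k 1) = (\<Sum>j\<in>UNIV. if j = k then \<gamma> j * u $ j else 0)"
    unfolding G_def by (intro sum.cong refl) (auto simp: axis_def)
  then show ?thesis by simp
qed

lemma G_nondegenerate: "(\<And>v. G u v = 0) \<Longrightarrow> u = 0"
  unfolding vec_eq_iff
proof
  fix k assume "\<And>v. G u v = 0"
  then show "u $ k = 0 $ k"
    using G_axis[of u k] \<gamma>[of k] by auto
qed

lemma G_eqI: "(\<And>w. G u w = G v w) \<Longrightarrow> u = v"
  using G_nondegenerate[of "u - v"] by simp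

lemma G_preserving_surj:
  assumes "linear A" "\<And>u v. G (A u) (A v) = G u v"
  shows "surj A"
proof -
  have "inj A"
    unfolding linear_injective_0[OF assms(1)]
    using assms(2) G_nondegenerate by (metis G_simps(9))
  then show ?thesis
    using assms(1) linear_injective_imp_surjective by blast
qed

text \<open>The endomorphism expressing \<open>omega\<close> through \<open>G\<close>. Its square is -1 on the planes with equal
  signs and 1 on the others.\<close>
definition J :: "real ^ ('n + 'n) \<Rightarrow> real ^ ('n + 'n)" where
  "J u = (\<chi> k. case k of Inl i \<Rightarrow> \<gamma> (Inl i) * u $ Inr i | Inr i \<Rightarrow> - \<gamma> (Inr i) * u $ Inl i)"

lemma sum_UNIV_plus: "(\<Sum>k\<in>UNIV. f (k :: 'n + 'n)) = (\<Sum>i\<in>UNIV. f (Inl i) + f (Inr i))"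
  by (subst UNIV_sum, subst sum.union_disjoint) (auto simp: sum.reindex sum.distrib)

lemma G_J: "G (J u) v = omega u v"
  by (simp add: G_def J_def omega_def sum_UNIV_plus mult.commute)

lemma J4: "J (J (J (J u))) = u"
  unfolding vec_eq_iff
proof
  fix k show "J (J (J (J u))) $ k = u $ k"
    using \<gamma>[of "Inl (case_sum id id k)"] \<gamma>[of "Inr (case_sum id id k)"]
    by (cases k) (auto simp: J_def)
qed

lemma J_scale: "J (r *\<^sub>R u) = r *\<^sub>R J u"
  by (simp add: J_def vec_eq_iff split: sum.split)

text \<open>Preserving \<open>G\<close> and scaling \<open>omega\<close> by \<open>\<mu>\<close> means \<open>J A = \<mu> A J\<close>. As the fourth power of \<open>J\<close> is the
  identity, the fourth power of \<open>\<mu>\<close> is 1.\<close>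
lemma conformal_factor_sq:
  assumes A: "linear A" and AG: "\<And>u v. G (A u) (A v) = G u v"
    and AO: "\<And>u v. omega (A u) (A v) = \<mu> * omega u v"
  shows "\<mu> * \<mu> = 1"
proof -
  have comm: "J (A u) = \<mu> *\<^sub>R A (J u)" for u
  proof (rule G_eqI)
    fix w obtain v where "w = A v"
      using G_preserving_surj[OF A AG] by (metis surjD)
    then show "G (J (A u)) w = G (\<mu> *\<^sub>R A (J u)) w"
      by (simp add: G_J AG AO)
  qed
  define u :: "real ^ ('n + 'n)" where "u = 1"
  have "A u = J (J (J (J (A u))))"
    by (simp add: J4)
  also have "\<dots> = (\<mu> * \<mu> * (\<mu> * \<mu>)) *\<^sub>R A u"
    by (simp add: comm J_scale J4 mult_ac)
  finally have "(\<mu> * \<mu> * (\<mu> * \<mu>) - 1) *\<^sub>R A u = 0"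
    by (simp only: scaleR_left_diff_distrib scaleR_one diff_self)
  moreover have "A u \<noteq> 0"
  proof
    assume "A u = 0"
    then have "u = 0"
      using AG[of u] by (intro G_nondegenerate) (metis G_simps(9))
    then show False by (simp add: u_def)
  qed
  ultimately have "(\<mu> * \<mu> - 1) * (\<mu> * \<mu> + 1) = 0"
    by (simp only: scaleR_eq_0_iff) (simp add: algebra_simps)
  moreover have "\<mu> * \<mu> + 1 > 0"
    by (simp add: add_nonneg_pos)
  ultimately show ?thesis by simp
qed

text \<open>The linear parts of isometries: the metric is preserved, and the symplectic form up to the sign by which
  the vertical coordinate is multiplied.\<close>
definition admissible :: "real ^ ('n + 'n) ^ ('n + 'n) \<Rightarrow> real \<Rightarrow> bool" where
  "admissible A \<mu> \<longleftrightarrow> (\<forall>u v. G (A *v u) (A *v v) = G u v) \<and>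
     (\<forall>u v. omega (A *v u) (A *v v) = \<mu> * omega u v) \<and> (\<mu> = 1 \<or> \<mu> = -1)"

text \<open>The automorphism \<open>(v, z) \<mapsto> (A v, \<mu> z)\<close> followed by left translation by \<open>(c, d)\<close>.\<close>
definition affine_iso :: "real ^ ('n + 'n) \<Rightarrow> real \<Rightarrow> real ^ ('n + 'n) ^ ('n + 'n) \<Rightarrow> real \<Rightarrow> 'n heis \<Rightarrow> 'n heis" where
  "affine_iso c d A \<mu> q = heis_of (c + A *v hcoord q) (d + \<mu> * vcoord q + omega c (A *v hcoord q) / 2)"

text \<open>Let \<open>\<theta>\<close> be the contact form and write \<open>f\<^sup>*\<theta> = \<lambda>\<theta>\<close>. The exterior derivative of this equation reads
  \<open>f\<^sup>*d\<theta> = d\<lambda> \<and> \<theta> + \<lambda> d\<theta>\<close>. On horizontal vectors it says that \<open>f\<close> scales the symplectic form by \<open>\<lambda>\<close>, so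
  \<open>\<lambda>\<^sup>2 = 1\<close> and \<open>d\<lambda> = 0\<close>. Then the equation for a horizontal and the vertical vector says that the image of the
  vertical vector has no horizontal component. The horizontal coordinates of \<open>f\<close> are therefore functions of the
  horizontal coordinates alone and preserve the flat metric \<open>G\<close>. Differentiating the metric gives a trilinear
  expression in second derivatives that is symmetric in one pair of arguments and skew in another, so it
  vanishes, and the horizontal coordinates are affine. The contact equation then determines the vertical one.\<close>
lemma isometry_imp_affine_iso:
  assumes f: "f \<in> isometries heis_H diag_metric"
  shows "\<exists>c d A \<mu>. admissible A \<mu> \<and> f = affine_iso c d A \<mu>"
proof -
  have sm: "smooth f" and H: "\<And>q. \<DD> f q ` heis_H q = heis_H (f q)"
    and g: "\<And>q a b. a \<in> heis_H q \<Longrightarrow> b \<in> heis_H q \<Longrightarrow> G (hcoord (\<DD> f q a)) (hcoord (\<DD> f q b)) = G (hcoord a) (hcoord b)"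
    using f unfolding isometries_def diffeomorphism_def diag_metric_def by blast+
  define F2 where "F2 x a b = \<DD> (\<lambda>y. \<DD> f y a) x b" for x a b
  have F2_sym: "F2 x a b = F2 x b a" for x a b
    unfolding F2_def by (rule smooth_second_derivative_commute[OF sm])
  have lin: "linear (\<DD> f x)" for x
    by (rule linear_frechet_derivative[OF sm])
  note lin_simps = linear_add[OF lin] linear_diff[OF lin] linear_cmul[OF lin] linear_0[OF lin]
  have d1: "(f has_derivative \<DD> f x) (at x)" for x
    by (rule smooth_has_derivative[OF sm])
  have d2: "((\<lambda>y. \<DD> f y a) has_derivative F2 x a) (at x)" for x a
    unfolding F2_def by (intro smooth_has_derivative smooth_derivative sm)
  define \<zeta> :: "'n heis" where "\<zeta> = heis_of 0 1"
  have \<zeta>[simp]: "contact_form q \<zeta> = 1" "hcoord \<zeta> = 0" for q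
    by (auto simp: \<zeta>_def contact_form_def)
  have hor: "a - contact_form q a *\<^sub>R \<zeta> \<in> heis_H q" for a q
    by (simp add: heis_H_iff_contact_form linear_diff[OF linear_contact_form] linear_cmul[OF linear_contact_form])
  define lam where "lam x = contact_form (f x) (\<DD> f x \<zeta>)" for x
  \<comment> \<open>the contact form is pulled back to a multiple of itself\<close>
  have pull: "contact_form (f x) (\<DD> f x a) = lam x * contact_form x a" for x a
  proof -
    have "\<DD> f x (a - contact_form x a *\<^sub>R \<zeta>) \<in> heis_H (f x)"
      using H[of x] hor[of a x] by blast
    then show ?thesis
      by (simp add: heis_H_iff_contact_form lin_simps linear_diff[OF linear_contact_form] linear_cmul[OF linear_contact_form]
          lam_def mult.commute)
  qed
  \<comment> \<open>both sides of the equation \<open>pull\<close> are differentiated, and the result \<open>ext\<close> is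
      antisymmetrized in the two directions; the second derivatives cancel\<close>
  have dpull: "((\<lambda>x. contact_form (f x) (\<DD> f x a)) has_derivative
      (\<lambda>b. vcoord (F2 x a b) - (omega (hcoord (f x)) (hcoord (F2 x a b)) + omega (hcoord (\<DD> f x b)) (hcoord (\<DD> f x a))) / 2)) (at x)" for x a
    unfolding contact_form_def
    by (intro has_derivative_diff bounded_linear.has_derivative[OF bounded_linear_divide] vcoord_has_derivative omega_has_derivative hcoord_has_derivative d1 d2)
  define lam' where "lam' x b = vcoord (F2 x \<zeta> b) -
      (omega (hcoord (f x)) (hcoord (F2 x \<zeta> b)) + omega (hcoord (\<DD> f x b)) (hcoord (\<DD> f x \<zeta>))) / 2" for x b
  have dlam: "(lam has_derivative lam' x) (at x)" for x
    using dpull[of \<zeta> x] by (simp add: lam_def[abs_def] lam'_def[abs_def])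
  have dtheta: "((\<lambda>x. contact_form x a) has_derivative (\<lambda>b. - omega (hcoord b) (hcoord a) / 2)) (at x)" for x a
  proof -
    have "((\<lambda>x. vcoord a - omega (hcoord x) (hcoord a) / 2) has_derivative
        (\<lambda>b. 0 - (omega (hcoord x) 0 + omega (hcoord b) (hcoord a)) / 2)) (at x)"
      by (intro has_derivative_diff has_derivative_const
          bounded_linear.has_derivative[OF bounded_linear_divide] omega_has_derivative
          hcoord_has_derivative has_derivative_ident)
    then show ?thesis
      by (simp add: contact_form_def)
  qed
  have ext: "vcoord (F2 x a b) - (omega (hcoord (f x)) (hcoord (F2 x a b)) + omega (hcoord (\<DD> f x b)) (hcoord (\<DD> f x a))) / 2
      = lam x * (- omega (hcoord b) (hcoord a) / 2) + lam' x b * contact_form x a" for x a b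
    using has_derivative_unique[OF dpull[of a x, unfolded pull] has_derivative_mult[OF dlam dtheta]]
    by (rule fun_cong)
  have dext: "omega (hcoord (\<DD> f x a)) (hcoord (\<DD> f x b)) =
      lam x * omega (hcoord a) (hcoord b) + lam' x b * contact_form x a - lam' x a * contact_form x b" for x a b
    using ext[of x a b] ext[of x b a] omega_commute[of "hcoord b" "hcoord a"]
      omega_commute[of "hcoord (\<DD> f x b)" "hcoord (\<DD> f x a)"] F2_sym[of x a b]
    by (simp add: field_simps)
  define A where "A x v = hcoord (\<DD> f x (hlift x v))" for x v
  have linA: "linear (A x)" for x
    unfolding A_def using linear_compose[OF linear_compose[OF linear_hlift lin] linear_hcoord]
    by (simp add: o_def)
  have lftH: "hlift x v \<in> heis_H x" for x v
    by (simp add: heis_H_eq)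
  have AG: "G (A x u) (A x v) = G u v" for x u v
    unfolding A_def using g[OF lftH lftH] by (simp add: hlift_def)
  have AO: "omega (A x u) (A x v) = lam x * omega u v" for x u v
    using lftH[of x u] lftH[of x v] unfolding A_def
    by (simp add: dext heis_H_iff_contact_form) (simp add: hlift_def)
  have lam_sq: "lam x * lam x = 1" for x
    by (rule conformal_factor_sq[OF linA AG AO])
  have surjA: "surj (A x)" for x
    by (rule G_preserving_surj[OF linA AG])
  \<comment> \<open>the conformal factor takes only the values 1 and -1, so it is constant\<close>
  have lam'_0: "lam' x b = 0" for x b
  proof -
    have "((\<lambda>x. lam x * lam x) has_derivative (\<lambda>b. lam x * lam' x b + lam' x b * lam x)) (at x)"
      by (intro has_derivative_mult dlam)
    then have "((\<lambda>x::'n heis. 1::real) has_derivative (\<lambda>b. lam x * lam' x b + lam' x b * lam x)) (at x)"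
      by (simp add: lam_sq)
    then have "lam x * lam' x b + lam' x b * lam x = 0"
      using fun_cong[OF has_derivative_unique[OF _ has_derivative_const]] by blast
    then show ?thesis
      using lam_sq[of x] by auto
  qed
  have vertical: "hcoord (\<DD> f x \<zeta>) = 0" for x
  proof (rule omega_nondegenerate)
    fix w obtain v where "w = A x v"
      using surjA[of x] by (metis surjD)
    then show "omega (hcoord (\<DD> f x \<zeta>)) w = 0"
      by (simp add: A_def dext lam'_0)
  qed
  have u_eq: "hcoord (\<DD> f x a) = A x (hcoord a)" for x a
  proof -
    have "a = hlift x (hcoord a) + contact_form x a *\<^sub>R \<zeta>"
      by (simp add: heis_eq_iff hlift_def contact_form_def \<zeta>_def)
    then have "hcoord (\<DD> f x a) = hcoord (\<DD> f x (hlift x (hcoord a) + contact_form x a *\<^sub>R \<zeta>))"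
      by simp
    then show ?thesis
      by (simp add: lin_simps vertical A_def)
  qed
  \<comment> \<open>the induced map of horizontal coordinates is an isometry of a flat metric, so it is affine\<close>
  have skew: "G (hcoord (F2 x a c)) (hcoord (\<DD> f x b)) = - G (hcoord (F2 x b c)) (hcoord (\<DD> f x a))" for x a b c
  proof -
    have "((\<lambda>x. G (hcoord (\<DD> f x a)) (hcoord (\<DD> f x b))) has_derivative
        (\<lambda>c. G (hcoord (\<DD> f x a)) (hcoord (F2 x b c)) + G (hcoord (F2 x a c)) (hcoord (\<DD> f x b)))) (at x)"
      by (intro G_has_derivative hcoord_has_derivative d2)
    then have "((\<lambda>x::'n heis. G (hcoord a) (hcoord b)) has_derivative
        (\<lambda>c. G (hcoord (\<DD> f x a)) (hcoord (F2 x b c)) + G (hcoord (F2 x a c)) (hcoord (\<DD> f x b)))) (at x)"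
      by (simp add: u_eq AG)
    then have "G (hcoord (\<DD> f x a)) (hcoord (F2 x b c)) + G (hcoord (F2 x a c)) (hcoord (\<DD> f x b)) = 0"
      using fun_cong[OF has_derivative_unique[OF _ has_derivative_const]] by blast
    then show ?thesis
      by (simp add: G_commute)
  qed
  have F2_0: "hcoord (F2 x a c) = 0" for x a c
  proof (rule G_nondegenerate)
    fix w obtain v where "w = A x v"
      using surjA[of x] by (metis surjD)
    then have w: "w = hcoord (\<DD> f x (hlift x v))"
      by (simp add: A_def)
    show "G (hcoord (F2 x a c)) w = 0"
      \<comment> \<open>each cyclic permutation of the three directions changes the sign, and three of them give the
          original expression back\<close>
      unfolding w using skew[of x a c "hlift x v"] skew[of x c "hlift x v" a] skew[of x "hlift x v" a c]
        F2_sym[of x "hlift x v"] F2_sym[of x c a] by simp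
  qed
  have const: "h x = h 0" if "\<And>x. (h has_derivative (\<lambda>b. 0)) (at x)" for h :: "'n heis \<Rightarrow> 'c::real_normed_vector" and x
    using has_derivative_zero_unique[of UNIV h x 0] that by auto
  have u': "hcoord (\<DD> f x a) = hcoord (\<DD> f 0 a)" for x a
    by (rule const) (use hcoord_has_derivative[OF d2] in \<open>simp add: F2_0\<close>)
  have lam: "lam x = lam 0" for x
    by (rule const) (use dlam in \<open>simp add: lam'_0[abs_def]\<close>)
  define M where "M = matrix (A 0)"
  have M: "M *v v = A 0 v" for v
    using fun_cong[OF matrix_vector_mul(2)[OF linA]] by (simp add: M_def)
  have adm: "admissible M (lam 0)"
    using lam_sq[of 0] by (simp add: admissible_def M AG AO square_eq_1_iff)
  have u_M: "hcoord (\<DD> f x a) = M *v hcoord a" for x a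
    using u'[of x a] u_eq[of 0 a] by (simp add: M)
  have hcoord_diff: "hcoord (f x) - M *v hcoord x = hcoord (f 0) - M *v hcoord 0" for x
  proof (rule const)
    fix x
    have "((\<lambda>x. hcoord (f x) - M *v hcoord x) has_derivative (\<lambda>a. hcoord (\<DD> f x a) - M *v hcoord a)) (at x)"
      by (intro has_derivative_diff hcoord_has_derivative d1
          bounded_linear.has_derivative[OF matrix_vector_mul_bounded_linear]) auto
    then show "((\<lambda>x. hcoord (f x) - M *v hcoord x) has_derivative (\<lambda>a. 0)) (at x)"
      by (simp add: u_M)
  qed
  have hvf: "hcoord (f x) = hcoord (f 0) + M *v hcoord x" for x
    using hcoord_diff[of x] by (simp add: diff_eq_eq)
  have vcoord': "vcoord (\<DD> f x a) = lam 0 * vcoord a + omega (hcoord (f 0)) (M *v hcoord a) / 2" for x a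
  proof -
    have "vcoord (\<DD> f x a) = lam 0 * contact_form x a + omega (hcoord (f x)) (hcoord (\<DD> f x a)) / 2"
      using pull[of x a] lam[of x] by (simp add: contact_form_def)
    also have "\<dots> = lam 0 * vcoord a + omega (hcoord (f 0)) (M *v hcoord a) / 2"
      using adm by (subst hvf) (simp add: u_M contact_form_def admissible_def field_simps)
    finally show ?thesis .
  qed
  have vcoord_diff: "vcoord (f x) - (lam 0 * vcoord x + omega (hcoord (f 0)) (M *v hcoord x) / 2) =
      vcoord (f 0) - (lam 0 * vcoord (0 :: 'n heis) + omega (hcoord (f 0)) (M *v hcoord 0) / 2)" for x
  proof (rule const[of "\<lambda>x. vcoord (f x) - (lam 0 * vcoord x + omega (hcoord (f 0)) (M *v hcoord x) / 2)"])
    fix x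
    have "((\<lambda>x. vcoord (f x) - (lam 0 * vcoord x + omega (hcoord (f 0)) (M *v hcoord x) / 2)) has_derivative
       (\<lambda>a. vcoord (\<DD> f x a) - (lam 0 * vcoord a + omega (hcoord (f 0)) (M *v hcoord a) / 2))) (at x)"
      by (intro has_derivative_diff has_derivative_add vcoord_has_derivative d1 has_derivative_mult_right
          bounded_linear.has_derivative[OF bounded_linear_divide] bounded_linear.has_derivative[OF bounded_bilinear.bounded_linear_right[OF bounded_bilinear_omega]]
          bounded_linear.has_derivative[OF matrix_vector_mul_bounded_linear] hcoord_has_derivative has_derivative_ident)
    then show "((\<lambda>x. vcoord (f x) - (lam 0 * vcoord x + omega (hcoord (f 0)) (M *v hcoord x) / 2)) has_derivative (\<lambda>a. 0)) (at x)"
      by (simp add: vcoord')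
  qed
  have hzf: "vcoord (f x) = vcoord (f 0) + lam 0 * vcoord x + omega (hcoord (f 0)) (M *v hcoord x) / 2" for x
    using vcoord_diff[of x] by (simp add: diff_eq_eq)
  have "f x = affine_iso (hcoord (f 0)) (vcoord (f 0)) M (lam 0) x" for x
    using hvf[of x] hzf[of x] by (simp only: affine_iso_def heis_eq_iff hcoord_heis_of vcoord_heis_of)
  then have "f = affine_iso (hcoord (f 0)) (vcoord (f 0)) M (lam 0)"
    by (rule HOL.ext)
  then show ?thesis
    using adm by blast
qed

end

lemma continuous_map_euclidean_tendsto:
  "continuous_map X euclidean f \<longleftrightarrow> (\<forall>x\<in>topspace X. (f \<longlongrightarrow> f x) (atin X x))"
  by (simp add: continuous_map_atin)

lemma second_countable_euclidean:
  "second_countable (euclidean :: 'a::second_countable_topology topology)"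
proof -
  obtain \<B> :: "'a set set" where \<B>: "countable \<B>" "topological_basis \<B>"
    using ex_countable_basis by blast
  show ?thesis
    unfolding second_countable_def
    using \<B> by (intro exI[of _ \<B>]) (simp add: topological_basis_open topological_basisE, metis topological_basisE)
qed

text \<open>A prefix form of the inverse, because \<open>inv\<close> denotes the inverse in a group structure here.\<close>
abbreviation inv_map :: "('a \<Rightarrow> 'b) \<Rightarrow> 'b \<Rightarrow> 'a" where "inv_map \<equiv> inv_into UNIV"

lemma tendsto_heis_of:
  "(f \<longlongrightarrow> v) F \<Longrightarrow> (g \<longlongrightarrow> z) F \<Longrightarrow> ((\<lambda>x. heis_of (f x) (g x)) \<longlongrightarrow> heis_of v z) F"
  unfolding heis_of_def by (intro tendsto_intros tendsto_vec_lambda)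

lemma bilinear_matrix_vector_mult: "bilinear ((*v) :: real ^ 'n ^ 'm \<Rightarrow> _)"
  unfolding bilinear_def
  by (auto intro!: linearI simp: matrix_vector_mult_def vec_eq_iff
      sum_distrib_left mult.assoc sum.distrib distrib_left distrib_right mult.left_commute)

lemmas matrix_vector_mult_tendsto =
  bounded_bilinear.tendsto[OF bilinear_conv_bounded_bilinear[THEN iffD1, OF bilinear_matrix_vector_mult]]
lemmas hcoord_tendsto = bounded_linear.tendsto[OF linear_conv_bounded_linear[THEN iffD1, OF linear_hcoord]]
lemmas vcoord_tendsto = bounded_linear.tendsto[OF linear_conv_bounded_linear[THEN iffD1, OF linear_vcoord]]
lemmas omega_tendsto = bounded_bilinear.tendsto[OF bounded_bilinear_omega]

context heis_metric
begin

abbreviation "I \<equiv> isometries heis_H diag_metric"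

text \<open>The four coefficients of an isometry are read off from its values at the origin, on the axes of the
  horizontal space and at the unit point of the vertical axis.\<close>
definition shift_h :: "('n heis \<Rightarrow> 'n heis) \<Rightarrow> real ^ ('n + 'n)" where "shift_h f = hcoord (f 0)"
definition shift_v :: "('n heis \<Rightarrow> 'n heis) \<Rightarrow> real" where "shift_v f = vcoord (f 0)"
definition lin_part :: "('n heis \<Rightarrow> 'n heis) \<Rightarrow> real ^ ('n + 'n) ^ ('n + 'n)" where
  "lin_part f = (\<chi> k l. hcoord (f (heis_of (axis l 1) 0)) $ k - hcoord (f 0) $ k)"
definition sign_part :: "('n heis \<Rightarrow> 'n heis) \<Rightarrow> real" where "sign_part f = vcoord (f (heis_of 0 1)) - vcoord (f 0)"

lemma affine_iso_parts [simp]: "shift_h (affine_iso c d A \<mu>) = c" "shift_v (affine_iso c d A \<mu>) = d" "lin_part (affine_iso c d A \<mu>) = A"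
    "sign_part (affine_iso c d A \<mu>) = \<mu>"
  by (simp_all add: shift_h_def shift_v_def lin_part_def sign_part_def affine_iso_def vec_eq_iff matrix_vector_mult_basis column_def)

section \<open>The group of isometries\<close>

lemma admissible_det: assumes "admissible A \<mu>" shows "det A \<noteq> 0"
proof -
  have "surj ((*v) A)"
    using assms by (intro G_preserving_surj) (auto simp: admissible_def)
  then show ?thesis
    using det_nz_iff_inj[of "(*v) A"] linear_surjective_imp_injective[of "(*v) A"] by simp
qed

lemma admissible_id: "admissible (mat 1) 1"
  by (simp add: admissible_def)

lemma admissible_mult: "admissible A \<mu> \<Longrightarrow> admissible B \<nu> \<Longrightarrow> admissible (A ** B) (\<mu> * \<nu>)"
  unfolding admissible_def by (auto simp: matrix_vector_mul_assoc[symmetric])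

lemma admissible_inv:
  assumes A: "admissible A \<mu>" shows "admissible (matrix_inv A) \<mu>"
proof -
  have *: "A *v (matrix_inv A *v v) = v" for v
    by (simp add: matrix_vector_mul_assoc matrix_inv_right[OF admissible_det[OF A]])
  have "G (matrix_inv A *v u) (matrix_inv A *v v) = G u v" for u v
    using A *[of u] *[of v] unfolding admissible_def by metis
  moreover have "omega (matrix_inv A *v u) (matrix_inv A *v v) = \<mu> * omega u v" for u v
  proof -
    have "omega u v = \<mu> * omega (matrix_inv A *v u) (matrix_inv A *v v)"
      using A *[of u] *[of v] unfolding admissible_def by metis
    then show ?thesis
      using A by (auto simp: admissible_def)
  qed
  ultimately show ?thesis
    using A by (simp add: admissible_def)
qed

lemma affine_iso_comp:
  assumes "admissible A \<mu>"
  shows "affine_iso c d A \<mu> \<circ> affine_iso c' d' A' \<mu>' =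
    affine_iso (c + A *v c') (d + \<mu> * d' + omega c (A *v c') / 2) (A ** A') (\<mu> * \<mu>')"
proof
  fix q
  have "\<mu> * omega c' (A' *v hcoord q) = omega (A *v c') (A *v (A' *v hcoord q))"
    using assms by (simp add: admissible_def)
  then show "(affine_iso c d A \<mu> \<circ> affine_iso c' d' A' \<mu>') q =
      affine_iso (c + A *v c') (d + \<mu> * d' + omega c (A *v c') / 2) (A ** A') (\<mu> * \<mu>') q"
    by (simp add: affine_iso_def heis_eq_iff matrix_vector_mul_assoc[symmetric] matrix_vector_right_distrib
        distrib_left add_divide_distrib)
qed

lemma affine_iso_id: "affine_iso 0 0 (mat 1) 1 = id"
  by (rule HOL.ext) (simp add: affine_iso_def heis_eq_iff)

lemma affine_iso_inverse:
  assumes A: "admissible A \<mu>"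
  shows "affine_iso c d A \<mu> \<circ> affine_iso (- (matrix_inv A *v c)) (- (\<mu> * d)) (matrix_inv A) \<mu> = id"
    "affine_iso (- (matrix_inv A *v c)) (- (\<mu> * d)) (matrix_inv A) \<mu> \<circ> affine_iso c d A \<mu> = id"
proof -
  note minv = matrix_inv_right[OF admissible_det[OF A]] matrix_inv_left[OF admissible_det[OF A]]
  have m: "\<mu> * \<mu> = 1" "\<mu> * (\<mu> * d) = d"
    using A by (auto simp: admissible_def)
  have neg: "B *v (- v) = - (B *v v)"
    for B :: "real ^ ('n + 'n) ^ ('n + 'n)" and v
    using linear_neg[OF matrix_vector_mul_linear[of B]] by simp
  show "affine_iso c d A \<mu> \<circ> affine_iso (- (matrix_inv A *v c)) (- (\<mu> * d)) (matrix_inv A) \<mu> = id"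
    by (simp add: affine_iso_comp[OF A] minv m neg matrix_vector_mul_assoc affine_iso_id)
  show "affine_iso (- (matrix_inv A *v c)) (- (\<mu> * d)) (matrix_inv A) \<mu> \<circ> affine_iso c d A \<mu> = id"
    by (simp add: affine_iso_comp[OF admissible_inv[OF A]] minv m affine_iso_id)
qed

lemma affine_iso_bij:
  assumes "admissible A \<mu>"
  shows "bij (affine_iso c d A \<mu>)"
    "inv_map (affine_iso c d A \<mu>) = affine_iso (- (matrix_inv A *v c)) (- (\<mu> * d)) (matrix_inv A) \<mu>"
  using o_bij[OF affine_iso_inverse(2,1)[OF assms]] inv_unique_comp[OF affine_iso_inverse[OF assms]] by auto

lemma linear_affine_iso_part: "linear (\<lambda>q. heis_of (A *v hcoord q) (\<mu> * vcoord q + omega c (A *v hcoord q) / 2))"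
  by (rule linearI) (simp_all add: heis_eq_iff matrix_vector_right_distrib matrix_vector_mult_scaleR field_simps)

lemma affine_iso_affine: "affine_iso c d A \<mu> = (\<lambda>q. heis_of c d + heis_of (A *v hcoord q) (\<mu> * vcoord q + omega c (A *v hcoord q) / 2))"
  by (rule HOL.ext) (simp add: affine_iso_def heis_eq_iff)

lemma smooth_affine_iso: "smooth (affine_iso c d A \<mu>)"
  unfolding affine_iso_affine by (rule smooth_affine[OF linear_affine_iso_part])

lemma derivative_affine_iso:
  "\<DD> (affine_iso c d A \<mu>) q = (\<lambda>a. heis_of (A *v hcoord a) (\<mu> * vcoord a + omega c (A *v hcoord a) / 2))"
  unfolding affine_iso_affine
  by (rule frechet_derivative_at[symmetric])
    (use has_derivative_add[OF has_derivative_const linear_imp_has_derivative[OF linear_affine_iso_part]]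
      in simp)

lemma derivative_affine_iso_hlift:
  assumes "admissible A \<mu>"
  shows "\<DD> (affine_iso c d A \<mu>) q (hlift q v) = hlift (affine_iso c d A \<mu> q) (A *v v)"
  using assms unfolding derivative_affine_iso by (simp add: hlift_def affine_iso_def heis_eq_iff admissible_def)

lemma affine_iso_isometry:
  assumes A: "admissible A \<mu>"
  shows "affine_iso c d A \<mu> \<in> I"
proof -
  have "surj ((*v) A)"
    using A by (intro G_preserving_surj) (auto simp: admissible_def)
  then have "\<DD> (affine_iso c d A \<mu>) q ` heis_H q = heis_H (affine_iso c d A \<mu> q)" for q
    using image_image[of "hlift (affine_iso c d A \<mu> q)" "(*v) A" UNIV]
    by (simp add: heis_H_eq image_image derivative_affine_iso_hlift[OF A])
  moreover have "diag_metric (affine_iso c d A \<mu> q) (\<DD> (affine_iso c d A \<mu>) q v) (\<DD> (affine_iso c d A \<mu>) q w) = diag_metric q v w" for q v w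
    using A by (simp add: diag_metric_def derivative_affine_iso admissible_def)
  ultimately show ?thesis
    unfolding isometries_def diffeomorphism_def
    by (simp add: affine_iso_bij[OF A] smooth_affine_iso)
qed

lemma isometryE:
  assumes "f \<in> I"
  shows "f = affine_iso (shift_h f) (shift_v f) (lin_part f) (sign_part f)" "admissible (lin_part f) (sign_part f)"
  using isometry_imp_affine_iso[OF assms] by auto

lemma isometry_comp:
  assumes f: "f \<in> I" and g: "g \<in> I"
  shows "f \<circ> g \<in> I" "shift_h (f \<circ> g) = shift_h f + lin_part f *v shift_h g"
    "shift_v (f \<circ> g) = shift_v f + sign_part f * shift_v g + omega (shift_h f) (lin_part f *v shift_h g) / 2"
    "lin_part (f \<circ> g) = lin_part f ** lin_part g" "sign_part (f \<circ> g) = sign_part f * sign_part g"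
proof -
  have eq: "f \<circ> g = affine_iso (shift_h f + lin_part f *v shift_h g) (shift_v f + sign_part f * shift_v g + omega (shift_h f) (lin_part f *v shift_h g) / 2)
      (lin_part f ** lin_part g) (sign_part f * sign_part g)"
    by (subst isometryE(1)[OF f], subst isometryE(1)[OF g]) (rule affine_iso_comp[OF isometryE(2)[OF f]])
  show "f \<circ> g \<in> I"
    unfolding eq by (intro affine_iso_isometry admissible_mult isometryE f g)
  show "shift_h (f \<circ> g) = shift_h f + lin_part f *v shift_h g"
    "shift_v (f \<circ> g) = shift_v f + sign_part f * shift_v g + omega (shift_h f) (lin_part f *v shift_h g) / 2"
    "lin_part (f \<circ> g) = lin_part f ** lin_part g" "sign_part (f \<circ> g) = sign_part f * sign_part g"
    unfolding eq by simp_all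
qed

lemma isometry_inv:
  assumes f: "f \<in> I"
  shows "inv_map f \<in> I" "shift_h (inv_map f) = - (matrix_inv (lin_part f) *v shift_h f)" "shift_v (inv_map f) = - (sign_part f * shift_v f)"
    "lin_part (inv_map f) = matrix_inv (lin_part f)" "sign_part (inv_map f) = sign_part f" "f \<circ> inv_map f = id" "inv_map f \<circ> f = id"
proof -
  have eq: "inv_map f = affine_iso (- (matrix_inv (lin_part f) *v shift_h f)) (- (sign_part f * shift_v f)) (matrix_inv (lin_part f)) (sign_part f)"
    by (subst isometryE(1)[OF f]) (rule affine_iso_bij[OF isometryE(2)[OF f]])
  show "inv_map f \<in> I"
    unfolding eq by (intro affine_iso_isometry admissible_inv isometryE f)
  show "shift_h (inv_map f) = - (matrix_inv (lin_part f) *v shift_h f)" "shift_v (inv_map f) = - (sign_part f * shift_v f)"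
    "lin_part (inv_map f) = matrix_inv (lin_part f)" "sign_part (inv_map f) = sign_part f"
    unfolding eq by simp_all
  have "bij f"
    using f by (simp add: isometries_def diffeomorphism_def)
  then show "f \<circ> inv_map f = id" "inv_map f \<circ> f = id"
    using surj_iff[THEN iffD1, OF bij_is_surj] inj_iff[THEN iffD1, OF bij_is_inj] by auto
qed

lemma id_isometry: "id \<in> I"
  using affine_iso_isometry[OF admissible_id, of 0 0] by (simp add: affine_iso_id)

abbreviation "GI \<equiv> isometry_group heis_H diag_metric"

lemma isometry_group_simps [simp]: "carrier GI = I" "f \<otimes>\<^bsub>GI\<^esub> g = f \<circ> g" "\<one>\<^bsub>GI\<^esub> = id"
  by (simp_all add: isometry_group_def)

lemma group_GI: "group GI"
proof (rule groupI)
  fix f assume "f \<in> carrier GI"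
  then show "\<exists>g\<in>carrier GI. g \<otimes>\<^bsub>GI\<^esub> f = \<one>\<^bsub>GI\<^esub>"
    using isometry_inv by (intro bexI[of _ "inv_map f"]) auto
qed (auto simp: isometry_comp(1) id_isometry o_assoc)

lemma m_inv_GI: "f \<in> I \<Longrightarrow> m_inv GI f = inv_map f"
  by (rule group.inv_equality[OF group_GI]) (simp_all add: isometry_inv)

section \<open>The compact-open topology\<close>

abbreviation "T \<equiv> compact_open_topology I"

lemma topspace_T: "topspace T = I"
proof -
  have "I \<in> {{f\<in>I. f ` K \<subseteq> U} | K U. compact K \<and> open U}"
    by (intro CollectI exI[of _ "{}"] exI[of _ UNIV]) simp
  then show ?thesis
    unfolding compact_open_topology_def topology_generated_by_topspace
    by (intro equalityI Union_upper Union_least) auto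
qed

lemma continuous_map_eval: "continuous_map T euclidean (\<lambda>f. f q)"
  unfolding continuous_map_def
proof (intro conjI allI impI)
  fix U :: "'n heis set" assume "openin euclidean U"
  then have "{f\<in>I. f ` {q} \<subseteq> U} \<in> {{f\<in>I. f ` K \<subseteq> U} | K U. compact K \<and> open U}"
    by (intro CollectI exI[of _ "{q}"] exI[of _ U]) simp
  then have "openin T {f\<in>I. f ` {q} \<subseteq> U}"
    unfolding compact_open_topology_def by (rule topology_generated_by_Basis)
  then show "openin T {f \<in> topspace T. f q \<in> U}"
    by (simp add: topspace_T)
qed auto

text \<open>Isometries are affine, so a family whose coefficients depend continuously on \<open>x\<close> is jointly
  continuous in \<open>x\<close> and the point. The tube lemma then provides a neighbourhood of \<open>x\<close> on which the family maps a
  given compact set into a given open set.\<close>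
lemma continuous_map_into_T:
  assumes I: "\<And>x. x \<in> topspace X \<Longrightarrow> F x \<in> I"
    and c: "continuous_map X euclidean (\<lambda>x. shift_h (F x))" and d: "continuous_map X euclidean (\<lambda>x. shift_v (F x))"
    and A: "continuous_map X euclidean (\<lambda>x. lin_part (F x))" and m: "continuous_map X euclidean (\<lambda>x. sign_part (F x))"
  shows "continuous_map X T F"
  unfolding compact_open_topology_def
proof (rule continuous_on_generated_topo)
  have "continuous_map (prod_topology X euclidean) euclidean
     (\<lambda>(x, q). affine_iso (shift_h (F x)) (shift_v (F x)) (lin_part (F x)) (sign_part (F x)) q)"
  proof -
    have 1: "continuous_map (prod_topology X euclidean) euclidean (\<lambda>p. g (fst p))"
      if "continuous_map X euclidean g" for g :: "'a \<Rightarrow> 'b::topological_space"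
      using continuous_map_compose[OF continuous_map_fst that] by (simp add: o_def)
    have 2: "continuous_map (prod_topology X euclidean) euclidean (snd :: _ \<Rightarrow> 'n heis)"
      by (rule continuous_map_snd)
    show ?thesis
      unfolding continuous_map_euclidean_tendsto
    proof
      fix p assume p: "p \<in> topspace (prod_topology X (euclidean :: 'n heis topology))"
      note lim = 1[OF c, unfolded continuous_map_euclidean_tendsto, rule_format, OF p]
        1[OF d, unfolded continuous_map_euclidean_tendsto, rule_format, OF p]
        1[OF A, unfolded continuous_map_euclidean_tendsto, rule_format, OF p]
        1[OF m, unfolded continuous_map_euclidean_tendsto, rule_format, OF p]
        2[unfolded continuous_map_euclidean_tendsto, rule_format, OF p]
      show "((\<lambda>(x, q). affine_iso (shift_h (F x)) (shift_v (F x)) (lin_part (F x)) (sign_part (F x)) q) \<longlongrightarrow>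
          (\<lambda>(x, q). affine_iso (shift_h (F x)) (shift_v (F x)) (lin_part (F x)) (sign_part (F x)) q) p)
          (atin (prod_topology X euclidean) p)"
        unfolding case_prod_unfold affine_iso_def
        by (intro tendsto_heis_of tendsto_add tendsto_mult tendsto_divide tendsto_const omega_tendsto
            matrix_vector_mult_tendsto hcoord_tendsto vcoord_tendsto lim) simp
    qed
  qed
  then have joint: "continuous_map (prod_topology X euclidean) euclidean (\<lambda>(x, q). F x q)"
    by (rule continuous_map_eq) (auto dest!: I isometryE(1))
  fix U assume "U \<in> {{f\<in>I. f ` K \<subseteq> U} | K U. compact K \<and> open U}"
  then obtain K V where U: "U = {f\<in>I. f ` K \<subseteq> V}" and KV: "compact K" "open V"
    by auto
  define W where "W = {xq \<in> topspace (prod_topology X euclidean). (\<lambda>(x, q). F x q) xq \<in> V}"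
  have W: "openin (prod_topology X euclidean) W"
    unfolding W_def using KV(2) by (intro openin_continuous_map_preimage[OF joint]) simp
  show "openin X (F -` U \<inter> topspace X)"
  proof (subst openin_subopen, intro ballI)
    fix x assume x: "x \<in> F -` U \<inter> topspace X"
    have "{x} \<times> K \<subseteq> W"
      using x by (auto simp: U W_def)
    then obtain M N where MN: "openin X M" "openin euclidean N" "{x} \<subseteq> M" "K \<subseteq> N" "M \<times> N \<subseteq> W"
      using Wallace_theorem_prod_topology[OF _ _ W, of "{x}" K] x KV(1) by auto
    have "M \<subseteq> F -` U \<inter> topspace X"
    proof
      fix y assume "y \<in> M"
      then have "y \<in> topspace X" "\<And>q. q \<in> K \<Longrightarrow> (y, q) \<in> W"
        using MN openin_subset by blast+
      then have "y \<in> topspace X" "\<forall>q\<in>K. F y q \<in> V"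
        by (simp_all add: W_def)
      then show "y \<in> F -` U \<inter> topspace X"
        using I by (auto simp: U)
    qed
    then show "\<exists>M. openin X M \<and> x \<in> M \<and> M \<subseteq> F -` U \<inter> topspace X"
      using MN by blast
  qed
next
  show "F ` topspace X \<subseteq> \<Union> {{f\<in>I. f ` K \<subseteq> U} | K U. compact K \<and> open U}"
    using I topspace_T unfolding compact_open_topology_def topology_generated_by_topspace
    by (simp only:) auto
qed

text \<open>An embedding into a Euclidean space, from which the group inherits separation and countability.\<close>
definition coefficients :: "('n heis \<Rightarrow> 'n heis) \<Rightarrow>
    (real ^ ('n + 'n)) \<times> real \<times> (real ^ ('n + 'n) ^ ('n + 'n)) \<times> real" where
  "coefficients f = (shift_h f, shift_v f, lin_part f, sign_part f)"

lemma continuous_map_coefficients: "continuous_map T euclidean coefficients"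
  unfolding continuous_map_euclidean_tendsto
proof
  fix f assume f: "f \<in> topspace T"
  have ev: "((\<lambda>f. f q) \<longlongrightarrow> f q) (atin T f)" for q
    using continuous_map_eval[of q, unfolded continuous_map_euclidean_tendsto] f by blast
  show "(coefficients \<longlongrightarrow> coefficients f) (atin T f)"
    unfolding coefficients_def shift_h_def shift_v_def lin_part_def sign_part_def
    by (intro tendsto_Pair tendsto_vec_lambda tendsto_diff tendsto_vec_nth hcoord_tendsto vcoord_tendsto ev)
qed

lemma homeomorphic_maps_coefficients:
  "homeomorphic_maps T (top_of_set (coefficients ` I)) coefficients (\<lambda>(c, d, A, m). affine_iso c d A m)"
  unfolding homeomorphic_maps_def
proof (intro conjI ballI)
  show "continuous_map T (top_of_set (coefficients ` I)) coefficients"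
    using continuous_map_coefficients by (simp add: continuous_map_in_subtopology topspace_T)
  have eq: "(\<lambda>(c, d, A, m). affine_iso c d A m) (coefficients f) = f" if "f \<in> I" for f
    using isometryE(1)[OF that] by (simp add: coefficients_def)
  have coefficients_eq: "coefficients ((\<lambda>(c, d, A, m). affine_iso c d A m) y) = y" for y
    by (simp add: coefficients_def split: prod.split)
  have cont: "continuous_map (top_of_set (coefficients ` I)) euclidean (\<lambda>y. g (coefficients ((\<lambda>(c, d, A, m). affine_iso c d A m) y)))"
    if "continuous_on UNIV g" for g :: "_ \<Rightarrow> 'c::topological_space"
    using continuous_on_subset[OF that] by (simp add: coefficients_eq)
  show "continuous_map (top_of_set (coefficients ` I)) T (\<lambda>(c, d, A, m). affine_iso c d A m)"
  proof (rule continuous_map_into_T)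
    fix y assume "y \<in> topspace (top_of_set (coefficients ` I))"
    then obtain f where "f \<in> I" "y = coefficients f" by auto
    then show "(\<lambda>(c, d, A, m). affine_iso c d A m) y \<in> I"
      using eq by metis
  next
    show "continuous_map (top_of_set (coefficients ` I)) euclidean (\<lambda>y. shift_h ((\<lambda>(c, d, A, m). affine_iso c d A m) y))"
      using cont[of fst] by (simp add: coefficients_def continuous_intros)
    show "continuous_map (top_of_set (coefficients ` I)) euclidean (\<lambda>y. shift_v ((\<lambda>(c, d, A, m). affine_iso c d A m) y))"
      using cont[of "\<lambda>y. fst (snd y)"] by (simp add: coefficients_def continuous_intros)
    show "continuous_map (top_of_set (coefficients ` I)) euclidean (\<lambda>y. lin_part ((\<lambda>(c, d, A, m). affine_iso c d A m) y))"
      using cont[of "\<lambda>y. fst (snd (snd y))"] by (simp add: coefficients_def continuous_intros)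
    show "continuous_map (top_of_set (coefficients ` I)) euclidean (\<lambda>y. sign_part ((\<lambda>(c, d, A, m). affine_iso c d A m) y))"
      using cont[of "\<lambda>y. snd (snd (snd y))"] by (simp add: coefficients_def continuous_intros)
  qed
  show "(\<lambda>(c, d, A, m). affine_iso c d A m) (coefficients f) = f" if "f \<in> topspace T" for f
    using eq that by (simp add: topspace_T)
  show "coefficients ((\<lambda>(c, d, A, m). affine_iso c d A m) y) = y" for y
    by (rule coefficients_eq)
qed

lemma Hausdorff_T: "Hausdorff_space T"
  using homeomorphic_Hausdorff_space[OF homeomorphic_maps_imp_homeomorphic_space[OF homeomorphic_maps_coefficients]]
  by (simp add: Hausdorff_space_subtopology)

lemma second_countable_T: "second_countable T"
  using homeomorphic_space_second_countability[OF homeomorphic_maps_imp_homeomorphic_space[OF homeomorphic_maps_coefficients]]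
    second_countable_subtopology[OF second_countable_euclidean] by blast

end

section \<open>Families of isometries\<close>

locale isometry_family = heis_metric \<gamma> + function_algebra S \<A>
  for \<gamma> :: "'n::finite + 'n \<Rightarrow> real" and S :: "'x set" and \<A> :: "('x \<Rightarrow> real) set"
begin

lemma vec_cong: "vec_in v \<Longrightarrow> (\<And>x. x \<in> S \<Longrightarrow> w x = v x) \<Longrightarrow> vec_in w"
  unfolding vec_in_def using cong by (metis (no_types, lifting))

lemma mat_cong: "mat_in A \<Longrightarrow> (\<And>x. x \<in> S \<Longrightarrow> B x = A x) \<Longrightarrow> mat_in B"
  unfolding mat_in_def using cong by (metis (no_types, lifting))

lemma omega_in: "vec_in u \<Longrightarrow> vec_in v \<Longrightarrow> (\<lambda>x. omega (u x) (v x)) \<in> \<A>"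
  unfolding omega_def by (intro sum diff mult) (simp_all add: vec_in_def)

text \<open>Families of isometries with coefficients in \<open>\<A>\<close>. Depending on \<open>\<A>\<close>, these are the continuous maps
  into the isometry group or the maps that are rational in given coordinates.\<close>
definition is_family :: "('x \<Rightarrow> 'n heis \<Rightarrow> 'n heis) \<Rightarrow> bool" where
  "is_family F \<longleftrightarrow> (\<forall>x\<in>S. F x \<in> I) \<and> vec_in (\<lambda>x. shift_h (F x)) \<and> (\<lambda>x. shift_v (F x)) \<in> \<A> \<and>
     mat_in (\<lambda>x. lin_part (F x)) \<and> (\<lambda>x. sign_part (F x)) \<in> \<A>"

lemma family_const: "f \<in> I \<Longrightarrow> is_family (\<lambda>x. f)"
  by (simp add: is_family_def vec_in_def mat_in_def const)

lemma family_comp: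
  assumes F: "is_family F" and H: "is_family H"
  shows "is_family (\<lambda>x. F x \<circ> H x)"
  unfolding is_family_def
proof (intro conjI)
  have I: "F x \<in> I" "H x \<in> I" if "x \<in> S" for x
    using F H that by (auto simp: is_family_def)
  note comp = isometry_comp[OF I]
  show "\<forall>x\<in>S. F x \<circ> H x \<in> I"
    using comp(1) by blast
  have F': "vec_in (\<lambda>x. shift_h (F x))" "(\<lambda>x. shift_v (F x)) \<in> \<A>" "mat_in (\<lambda>x. lin_part (F x))" "(\<lambda>x. sign_part (F x)) \<in> \<A>"
    and H': "vec_in (\<lambda>x. shift_h (H x))" "(\<lambda>x. shift_v (H x)) \<in> \<A>" "mat_in (\<lambda>x. lin_part (H x))" "(\<lambda>x. sign_part (H x)) \<in> \<A>"
    using F H by (auto simp: is_family_def)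
  show "vec_in (\<lambda>x. shift_h (F x \<circ> H x))"
    by (rule vec_cong[OF vec_add[OF F'(1) mat_vec_mult[OF F'(3) H'(1)]] comp(2)])
  show "(\<lambda>x. shift_v (F x \<circ> H x)) \<in> \<A>"
    by (rule cong[OF add[OF add[OF F'(2) mult[OF F'(4) H'(2)]]
            divide[OF omega_in[OF F'(1) mat_vec_mult[OF F'(3) H'(1)]] const]] comp(3)]) simp_all
  show "mat_in (\<lambda>x. lin_part (F x \<circ> H x))"
    by (rule mat_cong[OF mat_mult[OF F'(3) H'(3)] comp(4)])
  show "(\<lambda>x. sign_part (F x \<circ> H x)) \<in> \<A>"
    by (rule cong[OF mult[OF F'(4) H'(4)] comp(5)])
qed

lemma family_inv:
  assumes F: "is_family F"
  shows "is_family (\<lambda>x. inv_map (F x))"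
  unfolding is_family_def
proof (intro conjI)
  have I: "F x \<in> I" if "x \<in> S" for x
    using F that by (auto simp: is_family_def)
  note inv = isometry_inv[OF I]
  show "\<forall>x\<in>S. inv_map (F x) \<in> I"
    using inv(1) by blast
  have F': "vec_in (\<lambda>x. shift_h (F x))" "(\<lambda>x. shift_v (F x)) \<in> \<A>" "mat_in (\<lambda>x. lin_part (F x))" "(\<lambda>x. sign_part (F x)) \<in> \<A>"
    using F by (auto simp: is_family_def)
  have M: "mat_in (\<lambda>x. matrix_inv (lin_part (F x)))"
    by (rule mat_inv[OF F'(3)]) (use I isometryE(2) admissible_det in blast)
  show "vec_in (\<lambda>x. shift_h (inv_map (F x)))"
    by (rule vec_cong[OF vec_uminus[OF mat_vec_mult[OF M F'(1)]] inv(2)])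
  show "(\<lambda>x. shift_v (inv_map (F x))) \<in> \<A>"
    by (rule cong[OF uminus[OF mult[OF F'(4) F'(2)]] inv(3)])
  show "mat_in (\<lambda>x. lin_part (inv_map (F x)))"
    by (rule mat_cong[OF M inv(4)])
  show "(\<lambda>x. sign_part (inv_map (F x))) \<in> \<A>"
    by (rule cong[OF F'(4) inv(5)])
qed

end

context heis_metric
begin

abbreviation continuous_family :: "'a topology \<Rightarrow> ('a \<Rightarrow> 'n heis \<Rightarrow> 'n heis) \<Rightarrow> bool" where
  "continuous_family X \<equiv> isometry_family.is_family \<gamma> (topspace X) {f. continuous_map X euclideanreal f}"

lemma isometry_family_continuous:
  "isometry_family \<gamma> (topspace X) {f. continuous_map X euclideanreal f}"
  by (intro isometry_family.intro heis_metric_axioms function_algebra_continuous_map)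

lemma isometry_family_rational: "isometry_family \<gamma> S {f. rational_on m S f}"
  by (intro isometry_family.intro heis_metric_axioms function_algebra_rational)

text \<open>From right to left because the coefficients are continuous functions on the group, from left to right by
  \<open>continuous_map_into_T\<close>.\<close>
lemma continuous_family_iff: "continuous_family X F \<longleftrightarrow> continuous_map X T F"
proof -
  interpret isometry_family \<gamma> "topspace X" "{f. continuous_map X euclideanreal f}"
    by (rule isometry_family_continuous)
  show ?thesis
  proof
    assume F: "is_family F"
    have "continuous_map X euclideanreal (\<lambda>x. shift_h (F x) $ k)"
      "continuous_map X euclideanreal (\<lambda>x. lin_part (F x) $ j $ k)" for j k
      using F by (auto simp: is_family_def vec_in_def mat_in_def)
    then have "continuous_map X euclidean (\<lambda>x. shift_h (F x))" "continuous_map X euclidean (\<lambda>x. lin_part (F x))"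
      unfolding continuous_map_euclidean_tendsto by (auto intro!: vec_tendstoI)
    then show "continuous_map X T F"
      using F by (intro continuous_map_into_T) (auto simp: is_family_def)
  next
    assume F: "continuous_map X T F"
    have d: "continuous_map X euclidean (\<lambda>x. coefficients (F x))"
      using continuous_map_compose[OF F continuous_map_coefficients] by (simp add: o_def)
    have "F x \<in> I" if "x \<in> topspace X" for x
      using continuous_map_image_subset_topspace[OF F] that by (auto simp: topspace_T)
    moreover have "continuous_map X euclideanreal (\<lambda>x. shift_h (F x) $ k)"
      "continuous_map X euclideanreal (\<lambda>x. shift_v (F x))"
      "continuous_map X euclideanreal (\<lambda>x. lin_part (F x) $ k $ j)"
      "continuous_map X euclideanreal (\<lambda>x. sign_part (F x))" for k j
    proof -
      have lim: "continuous_map X euclideanreal (\<lambda>x. g (coefficients (F x)))" if "continuous_on UNIV g" for g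
        using continuous_map_compose[OF d, of euclideanreal g] that by (simp add: o_def)
      show "continuous_map X euclideanreal (\<lambda>x. shift_h (F x) $ k)"
        using lim[of "\<lambda>y. fst y $ k"] by (simp add: coefficients_def continuous_intros)
      show "continuous_map X euclideanreal (\<lambda>x. shift_v (F x))"
        using lim[of "\<lambda>y. fst (snd y)"] by (simp add: coefficients_def continuous_intros)
      show "continuous_map X euclideanreal (\<lambda>x. lin_part (F x) $ k $ j)"
        using lim[of "\<lambda>y. fst (snd (snd y)) $ k $ j"] by (simp add: coefficients_def continuous_intros)
      show "continuous_map X euclideanreal (\<lambda>x. sign_part (F x))"
        using lim[of "\<lambda>y. snd (snd (snd y))"] by (simp add: coefficients_def continuous_intros)
    qed
    ultimately show "is_family F"
      by (simp add: is_family_def vec_in_def mat_in_def)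
  qed
qed

lemma topological_group_GI: "topological_group GI T"
  unfolding topological_group_def
proof (intro conjI group_GI)
  show "topspace T = carrier GI"
    by (simp add: topspace_T)
  let ?P = "prod_topology T T"
  have "continuous_family ?P fst" "continuous_family ?P snd"
    unfolding continuous_family_iff by (rule continuous_map_fst continuous_map_snd)+
  then have "continuous_family ?P (\<lambda>p. fst p \<circ> snd p)"
    by (rule isometry_family.family_comp[OF isometry_family_continuous])
  then show "continuous_map ?P T (\<lambda>(f, g). f \<otimes>\<^bsub>GI\<^esub> g)"
    unfolding continuous_family_iff by (simp add: case_prod_unfold)
  have "continuous_family T (\<lambda>f. f)"
    unfolding continuous_family_iff using continuous_map_id by (simp add: id_def)
  then have "continuous_family T inv_map"
    by (rule isometry_family.family_inv[OF isometry_family_continuous])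
  then have "continuous_map T T inv_map"
    unfolding continuous_family_iff .
  then show "continuous_map T T (m_inv GI)"
    by (rule continuous_map_eq) (simp add: topspace_T m_inv_GI)
qed

section \<open>The Cayley transform\<close>

definition cayley :: "real ^ 'k::finite ^ 'k \<Rightarrow> real ^ 'k ^ 'k" where
  "cayley A = (mat 1 - A) ** matrix_inv (mat 1 + A)"

lemma det_nz_iff: "det A \<noteq> 0 \<longleftrightarrow> (\<forall>v. A *v v = 0 \<longrightarrow> v = 0)" for A :: "real ^ 'k::finite ^ 'k"
  using det_nz_iff_inj[of "(*v) A"] linear_injective_0[of "(*v) A"] by simp

lemma one_plus: "(mat 1 + A) *v v = v + A *v v" and one_minus: "(mat 1 - A) *v v = v - A *v v"
  for A :: "real ^ 'k::finite ^ 'k"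
  by (simp_all add: matrix_vector_mult_add_rdistrib matrix_vector_mult_diff_rdistrib)

text \<open>The relation between \<open>A\<close> and its transform without an inverse matrix: as \<open>1 + A\<close> is
  invertible, every vector is of the form \<open>v + A v\<close>, and the transform is
  \<open>v + A v \<mapsto> v - A v\<close>. This is symmetric in \<open>A\<close> and its transform up to a factor 2, so the transform is an involution.\<close>
lemma cayley_apply:
  assumes "det (mat 1 + A) \<noteq> 0"
  shows "cayley A *v (v + A *v v) = v - A *v v"
  unfolding cayley_def one_plus[symmetric] one_minus[symmetric]
  using matrix_inv_left[OF assms] by (simp add: matrix_vector_mul_assoc matrix_mul_assoc[symmetric])

lemma cayley_preimage:
  fixes A :: "real ^ 'k::finite ^ 'k"
  assumes "det (mat 1 + A) \<noteq> 0"
  obtains w where "v = w + A *v w"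
proof
  show "v = matrix_inv (mat 1 + A) *v v + A *v (matrix_inv (mat 1 + A) *v v)"
    unfolding one_plus[symmetric] by (simp add: matrix_vector_mul_assoc matrix_inv_right[OF assms])
qed

lemma cayley_unique:
  assumes "det (mat 1 + A) \<noteq> 0" and "\<And>v. B *v (v + A *v v) = v - A *v v"
  shows "B = cayley A"
  unfolding matrix_eq using assms cayley_preimage[OF assms(1)] cayley_apply[OF assms(1)] by metis

lemma det_one_plus_cayley:
  assumes A: "det (mat 1 + A) \<noteq> 0"
  shows "det (mat 1 + cayley A) \<noteq> 0"
  unfolding det_nz_iff
proof (intro allI impI)
  fix v assume v: "(mat 1 + cayley A) *v v = 0"
  obtain w where w: "v = w + A *v w"
    using cayley_preimage[OF A] .
  have "w + w = v + cayley A *v v"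
    unfolding w cayley_apply[OF A] by simp
  then have "w + w = 0"
    using v by (simp add: one_plus)
  then have "w = 0"
    by (simp add: scaleR_2[symmetric])
  then show "v = 0"
    using w by simp
qed

lemma cayley_cayley:
  assumes A: "det (mat 1 + A) \<noteq> 0"
  shows "cayley (cayley A) = A"
proof (rule cayley_unique[symmetric, OF det_one_plus_cayley[OF A]])
  fix v
  obtain w where w: "v = w + A *v w"
    using cayley_preimage[OF A] .
  show "A *v (v + cayley A *v v) = v - cayley A *v v"
  proof -
    have "v + cayley A *v v = w + w" "v - cayley A *v v = A *v w + A *v w"
      unfolding w cayley_apply[OF A] by simp_all
    then show ?thesis
      by (simp only: matrix_vector_right_distrib)
  qed
qed

text \<open>With \<open>x = u + A u\<close> and \<open>y = v + A v\<close> the skewness defect of the transform at \<open>(x, y)\<close> is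
  \<open>b (u - A u) (v + A v) + b (u + A u) (v - A v) = 2 (b u v - b (A u) (A v))\<close>.\<close>
lemma cayley_preserves_iff_skew:
  fixes b :: "real ^ 'k::finite \<Rightarrow> real ^ 'k \<Rightarrow> real"
  assumes b: "bilinear b" and A: "det (mat 1 + A) \<noteq> 0"
  shows "(\<forall>u v. b (cayley A *v u) v + b u (cayley A *v v) = 0) \<longleftrightarrow> (\<forall>u v. b (A *v u) (A *v v) = b u v)"
proof -
  note b_simps = bilinear_ladd[OF b] bilinear_radd[OF b] bilinear_lsub[OF b] bilinear_rsub[OF b]
  have "b (cayley A *v (u + A *v u)) (v + A *v v) + b (u + A *v u) (cayley A *v (v + A *v v)) =
      2 * (b u v - b (A *v u) (A *v v))" for u v
    unfolding cayley_apply[OF A] by (simp add: b_simps)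
  then have *: "b (cayley A *v (u + A *v u)) (v + A *v v) + b (u + A *v u) (cayley A *v (v + A *v v)) = 0 \<longleftrightarrow>
      b (A *v u) (A *v v) = b u v" for u v
    by auto
  show ?thesis
  proof
    assume "\<forall>u v. b (cayley A *v u) v + b u (cayley A *v v) = 0"
    then show "\<forall>u v. b (A *v u) (A *v v) = b u v"
      using * by blast
  next
    assume R: "\<forall>u v. b (A *v u) (A *v v) = b u v"
    show "\<forall>u v. b (cayley A *v u) v + b u (cayley A *v v) = 0"
    proof (intro allI)
      fix u v
      obtain u' v' where "u = u' + A *v u'" "v = v' + A *v v'"
        using cayley_preimage[OF A] by metis
      then show "b (cayley A *v u) v + b u (cayley A *v v) = 0"
        using * R by simp
    qed
  qed
qed

section \<open>The Lie algebra of the isotropy group\<close>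

definition liealg :: "real ^ ('n + 'n) ^ ('n + 'n) \<Rightarrow> bool" where
  "liealg X \<longleftrightarrow> (\<forall>u v. G (X *v u) v + G u (X *v v) = 0) \<and> (\<forall>u v. omega (X *v u) v + omega u (X *v v) = 0)"

lemma liealg_cayley_iff:
  assumes "det (mat 1 + A) \<noteq> 0"
  shows "liealg (cayley A) \<longleftrightarrow> admissible A 1"
  unfolding liealg_def admissible_def
  using cayley_preserves_iff_skew[OF bilinear_G assms] cayley_preserves_iff_skew[OF bilinear_omega assms] by simp

text \<open>The planes \<open>i\<close> and \<open>j\<close> are both definite or both indefinite.\<close>
definition same_type :: "'n \<Rightarrow> 'n \<Rightarrow> bool" where
  "same_type i j \<longleftrightarrow> \<gamma> (Inl i) * \<gamma> (Inr i) = \<gamma> (Inl j) * \<gamma> (Inr j)"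

text \<open>In block form with respect to the \<open>X\<close> and \<open>Y\<close> directions, a matrix that is skew for both forms is
  determined by its first row of blocks. There the \<open>\<gamma>\<close>-twisted first block is skew and the second one is
  symmetric, so their sum, an arbitrary matrix apart from zeros between planes of different type, contains
  both of them.\<close>
definition lie_coords :: "real ^ ('n + 'n) ^ ('n + 'n) \<Rightarrow> 'n \<Rightarrow> 'n \<Rightarrow> real" where
  "lie_coords X i j = \<gamma> (Inl i) * X $ Inl i $ Inl j + X $ Inl i $ Inr j"

text \<open>The inverse of \<open>lie_coords\<close>: skew and symmetric part of \<open>W\<close> recover the first row of blocks, and
  skewness for \<open>G\<close> and \<open>omega\<close> dictates the second row.\<close>
definition lie_matrix :: "('n \<Rightarrow> 'n \<Rightarrow> real) \<Rightarrow> real ^ ('n + 'n) ^ ('n + 'n)" where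
  "lie_matrix W = (\<chi> k l. case k of
     Inl i \<Rightarrow> (case l of Inl j \<Rightarrow> \<gamma> (Inl i) * (W i j - W j i) / 2
                     | Inr j \<Rightarrow> (W i j + W j i) / 2)
   | Inr i \<Rightarrow> (case l of Inl j \<Rightarrow> - (\<gamma> (Inr i) * \<gamma> (Inl j) * (W i j + W j i)) / 2
                     | Inr j \<Rightarrow> - (\<gamma> (Inl j) * (W j i - W i j)) / 2))"

lemma lie_matrix_simps:
  "lie_matrix W $ Inl i $ Inl j = \<gamma> (Inl i) * (W i j - W j i) / 2"
  "lie_matrix W $ Inl i $ Inr j = (W i j + W j i) / 2"
  "lie_matrix W $ Inr i $ Inl j = - (\<gamma> (Inr i) * \<gamma> (Inl j) * (W i j + W j i)) / 2"
  "lie_matrix W $ Inr i $ Inr j = - (\<gamma> (Inl j) * (W j i - W i j)) / 2"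
  by (simp_all add: lie_matrix_def)

lemma lie_coords_lie_matrix: "lie_coords (lie_matrix W) i j = W i j"
  by (simp add: lie_coords_def lie_matrix_simps field_simps)

lemma bilinear_skew:
  fixes X :: "real ^ 'k::finite ^ 'k"
  assumes b: "bilinear b"
  shows "(\<forall>u v. b (X *v u) v + b u (X *v v) = 0) \<longleftrightarrow>
    (\<forall>k l. b (X *v axis k 1) (axis l 1) + b (axis k 1) (X *v axis l 1) = (0::real))"
    (is "?L \<longleftrightarrow> ?R")
proof
  assume R: ?R
  have "bilinear (\<lambda>u v. b (X *v u) v)" "bilinear (\<lambda>u v. - b u (X *v v))"
    unfolding bilinear_def
    by (intro conjI allI linearI; simp add: bilinear_ladd[OF b] bilinear_radd[OF b] bilinear_lmul[OF b]
        bilinear_rmul[OF b] matrix_vector_right_distrib matrix_vector_mult_scaleR)+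
  then have "(\<lambda>u v. b (X *v u) v) = (\<lambda>u v. - b u (X *v v))"
  proof (rule bilinear_eq_stdbasis)
    fix i j :: "real ^ 'k" assume "i \<in> Basis" "j \<in> Basis"
    then obtain k l where "i = axis k 1" "j = axis l 1"
      by (auto simp: Basis_vec_def)
    then show "b (X *v i) j = - b i (X *v j)"
      using R by (simp add: eq_neg_iff_add_eq_0)
  qed
  then show ?L
    by (simp add: fun_eq_iff)
qed simp

lemma G_axis': "G (axis k 1) u = \<gamma> k * u $ k"
  by (simp add: G_commute[of "axis k 1"] G_axis)

lemma omega_axis': "omega (axis (Inl i) 1) u = - u $ Inr i" "omega (axis (Inr i) 1) u = u $ Inl i"
  by (simp_all add: omega_commute[of "axis _ 1"] omega_axis)

lemma mult_axis: "(X *v axis k 1) $ l = X $ l $ k" for X :: "real ^ 'k::finite ^ 'k"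
  by (simp add: matrix_vector_mult_basis column_def)

lemma liealg_iff:
  "liealg X \<longleftrightarrow> (\<forall>k l. \<gamma> l * X $ l $ k + \<gamma> k * X $ k $ l = 0) \<and>
     (\<forall>i j. X $ Inr j $ Inl i = X $ Inr i $ Inl j \<and> X $ Inl j $ Inr i = X $ Inl i $ Inr j \<and>
        X $ Inr i $ Inr j = - X $ Inl j $ Inl i)"
proof -
  have all_sum: "(\<forall>k. P k) \<longleftrightarrow> (\<forall>i. P (Inl i)) \<and> (\<forall>i. P (Inr i))" for P :: "'n + 'n \<Rightarrow> bool"
    by (metis sumE)
  have "(\<forall>k l. omega (X *v axis k 1) (axis l 1) + omega (axis k 1) (X *v axis l 1) = 0) \<longleftrightarrow>
     (\<forall>i j. X $ Inr j $ Inl i = X $ Inr i $ Inl j \<and> X $ Inl j $ Inr i = X $ Inl i $ Inr j \<and>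
        X $ Inr i $ Inr j = - X $ Inl j $ Inl i)"
    by (subst all_sum, subst all_sum, subst all_sum) (auto simp: omega_axis omega_axis' mult_axis add_eq_0_iff)
  then show ?thesis
    unfolding liealg_def bilinear_skew[OF bilinear_G] bilinear_skew[OF bilinear_omega]
    by (simp add: G_axis G_axis' mult_axis)
qed

lemma same_type_iff: "same_type i j \<longleftrightarrow> \<gamma> (Inr i) * \<gamma> (Inl j) = \<gamma> (Inr j) * \<gamma> (Inl i)"
  using \<gamma>[of "Inl i"] \<gamma>[of "Inl j"] \<gamma>[of "Inr i"] \<gamma>[of "Inr j"] by (auto simp: same_type_def)

lemma liealg_lie_matrix:
  assumes "\<And>i j. \<not> same_type i j \<Longrightarrow> W i j = 0"
  shows "liealg (lie_matrix W)"
proof -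
  have W: "W i j = 0 \<and> W j i = 0 \<or> \<gamma> (Inr i) * \<gamma> (Inl j) = \<gamma> (Inr j) * \<gamma> (Inl i)" for i j
    using assms[of i j] assms[of j i] same_type_iff[of i j] same_type_iff[of j i] by auto
  have "\<gamma> l * lie_matrix W $ l $ k + \<gamma> k * lie_matrix W $ k $ l = 0" for k l
  proof (cases k; cases l)
    fix i j assume "k = Inr i" "l = Inr j"
    then show ?thesis
      using W[of i j] by (auto simp: lie_matrix_simps field_simps)
  qed (auto simp: lie_matrix_simps field_simps)
  moreover have "lie_matrix W $ Inr j $ Inl i = lie_matrix W $ Inr i $ Inl j" for i j
    using W[of i j] by (auto simp: lie_matrix_simps)
  ultimately show ?thesis
    unfolding liealg_iff by (simp add: lie_matrix_simps)
qed

text \<open>Each entry between planes \<open>i\<close> and \<open>j\<close> is subject to two relations from \<open>G\<close>, which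
  \<open>omega\<close> turns into relations for the same entry. If the planes are of different type, these two force it to
  be zero.\<close>
lemma liealg_lie_coords:
  assumes X: "liealg X"
  shows "lie_matrix (lie_coords X) = X" and "\<And>i j. \<not> same_type i j \<Longrightarrow> lie_coords X i j = 0"
proof -
  have g: "\<gamma> l * X $ l $ k + \<gamma> k * X $ k $ l = 0" for k l
    using X by (simp add: liealg_iff)
  have R: "X $ Inr j $ Inl i = X $ Inr i $ Inl j" and Q: "X $ Inl j $ Inr i = X $ Inl i $ Inr j"
    and P: "X $ Inr i $ Inr j = - X $ Inl j $ Inl i" for i j
    using X by (auto simp: liealg_iff)
  have "lie_matrix (lie_coords X) $ k $ l = X $ k $ l" for k l
  proof -
    obtain i where i: "k = Inl i \<or> k = Inr i" by (cases k) auto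
    obtain j where j: "l = Inl j \<or> l = Inr j" by (cases l) auto
    show ?thesis
      using i j g[of "Inl i" "Inl j"] g[of "Inr i" "Inl j"] Q[of i j] P[of i j]
        \<gamma>[of "Inl i"] \<gamma>[of "Inl j"] \<gamma>[of "Inr i"] \<gamma>[of "Inr j"]
      by (elim disjE) (simp_all add: lie_matrix_simps lie_coords_def)
  qed
  then show "lie_matrix (lie_coords X) = X"
    by (simp add: vec_eq_iff)
  show "lie_coords X i j = 0" if "\<not> same_type i j" for i j
    using that g[of "Inl i" "Inl j"] g[of "Inr i" "Inr j"] g[of "Inr i" "Inl j"] g[of "Inl i" "Inr j"]
      P[of i j] P[of j i] Q[of i j] R[of i j]
      \<gamma>[of "Inl i"] \<gamma>[of "Inl j"] \<gamma>[of "Inr i"] \<gamma>[of "Inr j"]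
    by (elim disjE) (simp_all add: same_type_def lie_coords_def)
qed

end

section \<open>Charts of the isometry group\<close>

context heis_metric
begin

text \<open>Coordinates of the group: those of the horizontal translation, the vertical translation, and the
  entries of \<open>lie_coords\<close> that may be nonzero.\<close>
definition chart_index :: "((('n + 'n) + unit) + 'n \<times> 'n) set" where
  "chart_index = range Inl \<union> Inr ` {(i, j). same_type i j}"

definition isometry_dim :: nat where "isometry_dim = card chart_index"

definition index_enum :: "nat \<Rightarrow> (('n + 'n) + unit) + 'n \<times> 'n" where
  "index_enum = (SOME e. bij_betw e {..<isometry_dim} chart_index)"

definition index_pos :: "(('n + 'n) + unit) + 'n \<times> 'n \<Rightarrow> nat" where
  "index_pos = inv_into {..<isometry_dim} index_enum"

definition lie_of_coords :: "(nat \<Rightarrow> real) \<Rightarrow> real ^ ('n + 'n) ^ ('n + 'n)" where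
  "lie_of_coords p = lie_matrix (\<lambda>i j. if same_type i j then p (index_pos (Inr (i, j))) else 0)"

definition chart_isometry :: "(nat \<Rightarrow> real) \<Rightarrow> 'n heis \<Rightarrow> 'n heis" where
  "chart_isometry p = affine_iso (\<chi> k. p (index_pos (Inl (Inl k)))) (p (index_pos (Inl (Inr ())))) (cayley (lie_of_coords p)) 1"

definition chart_coords :: "('n heis \<Rightarrow> 'n heis) \<Rightarrow> nat \<Rightarrow> real" where
  "chart_coords f = (\<lambda>i. if i < isometry_dim then
     (case index_enum i of Inl (Inl k) \<Rightarrow> shift_h f $ k | Inl (Inr _) \<Rightarrow> shift_v f
        | Inr (i, j) \<Rightarrow> lie_coords (cayley (lin_part f)) i j) else 0)"

definition chart_domain :: "(nat \<Rightarrow> real) set" where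
  "chart_domain = {p \<in> topspace (Euclidean_space isometry_dim). det (mat 1 + lie_of_coords p) \<noteq> 0}"

text \<open>Positivity of the sign part excludes the isometries that reverse the vertical direction, and the
  determinant condition makes the Cayley transform available.\<close>
definition chart_nbhd :: "('n heis \<Rightarrow> 'n heis) set" where
  "chart_nbhd = {f \<in> I. 0 < sign_part f \<and> det (mat 1 + lin_part f) \<noteq> 0}"

lemma index_enum: "bij_betw index_enum {..<isometry_dim} chart_index"
proof -
  have "finite chart_index" by simp
  then have "\<exists>e. bij_betw e {..<isometry_dim} chart_index"
    unfolding isometry_dim_def using ex_bij_betw_nat_finite[of chart_index] by (simp add: lessThan_atLeast0)
  then show ?thesis
    unfolding index_enum_def by (rule someI_ex)
qed

lemma index_enum_index_pos: "x \<in> chart_index \<Longrightarrow> index_enum (index_pos x) = x" and index_pos_less: "x \<in> chart_index \<Longrightarrow> index_pos x < isometry_dim"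
  unfolding index_pos_def using index_enum bij_betw_inv_into_right[OF index_enum] inv_into_into[of x index_enum "{..<isometry_dim}"]
  by (auto simp: bij_betw_def)

lemma index_pos_index_enum: "i < isometry_dim \<Longrightarrow> index_pos (index_enum i) = i"
  unfolding index_pos_def using bij_betw_inv_into_left[OF index_enum] by simp

lemma index_enum_chart_index: "i < isometry_dim \<Longrightarrow> index_enum i \<in> chart_index"
  using index_enum by (auto simp: bij_betw_def)

lemma chart_index_simps [simp]: "Inl a \<in> chart_index" "Inr (i, j) \<in> chart_index \<longleftrightarrow> same_type i j"
  by (auto simp: chart_index_def)

lemma liealg_lie_of_coords: "liealg (lie_of_coords p)"
  unfolding lie_of_coords_def by (rule liealg_lie_matrix) simp

lemma chart_isometry_chart_nbhd:
  assumes p: "p \<in> chart_domain"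
  shows "chart_isometry p \<in> chart_nbhd"
proof -
  have d: "det (mat 1 + lie_of_coords p) \<noteq> 0"
    using p by (simp add: chart_domain_def)
  have "admissible (cayley (lie_of_coords p)) 1"
    using liealg_lie_of_coords[of p] liealg_cayley_iff[OF det_one_plus_cayley[OF d]] by (simp add: cayley_cayley[OF d])
  then show ?thesis
    using det_one_plus_cayley[OF d] by (simp add: chart_nbhd_def chart_isometry_def affine_iso_isometry)
qed

lemma chart_coords_chart_isometry:
  assumes p: "p \<in> chart_domain"
  shows "chart_coords (chart_isometry p) = p"
proof
  fix i
  have d: "det (mat 1 + lie_of_coords p) \<noteq> 0" and p0: "isometry_dim \<le> i \<Longrightarrow> p i = 0"
    using p by (auto simp: chart_domain_def topspace_Euclidean_space)
  have *: "lie_coords (cayley (cayley (lie_of_coords p))) j k = (if same_type j k then p (index_pos (Inr (j, k))) else 0)" for j k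
    unfolding cayley_cayley[OF d] by (simp add: lie_of_coords_def lie_coords_lie_matrix)
  show "chart_coords (chart_isometry p) i = p i"
  proof (cases "i < isometry_dim")
    case True
    then show ?thesis
      using index_enum_chart_index[OF True] index_pos_index_enum[OF True]
      by (auto simp: chart_coords_def chart_isometry_def * split: sum.split prod.split)
  qed (simp add: chart_coords_def p0)
qed

lemma lie_of_coords_chart_coords:
  assumes f: "f \<in> chart_nbhd"
  shows "lie_of_coords (chart_coords f) = cayley (lin_part f)"
proof -
  have "sign_part f = 1"
    using f isometryE(2)[of f] by (auto simp: chart_nbhd_def admissible_def)
  then have "liealg (cayley (lin_part f))"
    using f isometryE(2)[of f] by (simp add: chart_nbhd_def liealg_cayley_iff)
  note W = liealg_lie_coords[OF this]
  have "(\<lambda>i j. if same_type i j then chart_coords f (index_pos (Inr (i, j))) else 0) = lie_coords (cayley (lin_part f))"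
    by (intro HOL.ext) (simp add: W(2) chart_coords_def index_enum_index_pos index_pos_less)
  then have "lie_of_coords (chart_coords f) = lie_matrix (lie_coords (cayley (lin_part f)))"
    unfolding lie_of_coords_def by (rule arg_cong)
  then show ?thesis
    by (simp only: W(1))
qed

lemma chart_coords_chart_domain:
  assumes f: "f \<in> chart_nbhd"
  shows "chart_coords f \<in> chart_domain"
  using f det_one_plus_cayley[of "lin_part f"]
  by (simp add: chart_domain_def lie_of_coords_chart_coords chart_nbhd_def topspace_Euclidean_space) (simp add: chart_coords_def)

lemma chart_isometry_chart_coords:
  assumes f: "f \<in> chart_nbhd"
  shows "chart_isometry (chart_coords f) = f"
proof -
  have I: "f \<in> I" and d: "det (mat 1 + lin_part f) \<noteq> 0"
    using f by (auto simp: chart_nbhd_def)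
  have "sign_part f = 1"
    using f isometryE(2)[of f] by (auto simp: chart_nbhd_def admissible_def)
  moreover have "(\<chi> k. chart_coords f (index_pos (Inl (Inl k)))) = shift_h f" "chart_coords f (index_pos (Inl (Inr ()))) = shift_v f"
    by (simp_all add: chart_coords_def index_enum_index_pos index_pos_less vec_eq_iff)
  ultimately show ?thesis
    using isometryE(1)[OF I] by (simp add: chart_isometry_def lie_of_coords_chart_coords[OF f] cayley_cayley[OF d])
qed

end

context isometry_family
begin

lemma lie_of_coords_in:
  assumes a: "\<And>i. i < isometry_dim \<Longrightarrow> (\<lambda>x. a x i) \<in> \<A>"
  shows "mat_in (\<lambda>x. lie_of_coords (a x))"
proof -
  have w: "(\<lambda>x. if same_type i j then a x (index_pos (Inr (i, j))) else 0) \<in> \<A>" for i j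
    using a[of "index_pos (Inr (i, j))"] index_pos_less[of "Inr (i, j)"] const[of 0] by (cases "same_type i j") auto
  show ?thesis
    unfolding mat_in_def
  proof (intro allI)
    fix k l show "(\<lambda>x. lie_of_coords (a x) $ k $ l) \<in> \<A>"
      unfolding lie_of_coords_def
      by (cases k; cases l; simp only: lie_matrix_simps; intro divide mult const add diff uminus w) simp_all
  qed
qed

lemma cayley_in:
  assumes "mat_in A" "\<And>x. x \<in> S \<Longrightarrow> det (mat 1 + A x) \<noteq> 0"
  shows "mat_in (\<lambda>x. cayley (A x))"
  unfolding cayley_def by (intro mat_mult mat_inv mat_diff mat_add mat_const assms)

lemma family_chart_isometry:
  assumes a: "\<And>i. i < isometry_dim \<Longrightarrow> (\<lambda>x. a x i) \<in> \<A>" and D: "\<And>x. x \<in> S \<Longrightarrow> a x \<in> chart_domain"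
  shows "is_family (\<lambda>x. chart_isometry (a x))"
  unfolding is_family_def
proof (intro conjI ballI)
  show "chart_isometry (a x) \<in> I" if "x \<in> S" for x
    using chart_isometry_chart_nbhd[OF D[OF that]] by (simp add: chart_nbhd_def)
  show "mat_in (\<lambda>x. lin_part (chart_isometry (a x)))"
    unfolding chart_isometry_def affine_iso_parts using D by (intro cayley_in lie_of_coords_in a) (auto simp: chart_domain_def)
qed (auto simp: chart_isometry_def vec_in_def intro!: a index_pos_less const)

lemma chart_coords_in:
  assumes F: "is_family F" and U: "\<And>x. x \<in> S \<Longrightarrow> F x \<in> chart_nbhd"
  shows "(\<lambda>x. chart_coords (F x) i) \<in> \<A>"
proof (cases "i < isometry_dim")
  case True
  have F': "vec_in (\<lambda>x. shift_h (F x))" "(\<lambda>x. shift_v (F x)) \<in> \<A>" "mat_in (\<lambda>x. lin_part (F x))"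
    using F by (auto simp: is_family_def)
  have "mat_in (\<lambda>x. cayley (lin_part (F x)))"
    using U by (intro cayley_in F') (auto simp: chart_nbhd_def)
  then have "(\<lambda>x. lie_coords (cayley (lin_part (F x))) j k) \<in> \<A>" for j k
    unfolding lie_coords_def by (intro add mult const) (auto simp: mat_in_def)
  moreover obtain k j l where "index_enum i = Inl (Inl k) \<or> index_enum i = Inl (Inr ()) \<or> index_enum i = Inr (j, l)"
    by (metis sumE unit.exhaust prod.exhaust)
  ultimately show ?thesis
    using F' True by (auto simp: chart_coords_def vec_in_def)
qed (simp add: chart_coords_def const)

end

context heis_metric
begin

lemma openin_chart_nbhd_preimage:
  assumes "continuous_family X F"
  shows "openin X {x \<in> topspace X. F x \<in> chart_nbhd}"
proof -
  interpret isometry_family \<gamma> "topspace X" "{f. continuous_map X euclideanreal f}"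
    by (rule isometry_family_continuous)
  have c: "continuous_map X euclideanreal (\<lambda>x. sign_part (F x))" "mat_in (\<lambda>x. lin_part (F x))"
    using assms by (auto simp: is_family_def)
  then have "continuous_map X euclideanreal (\<lambda>x. det (mat 1 + lin_part (F x)))"
    using det[OF mat_add[OF mat_const c(2)]] by simp
  then have "openin X {x \<in> topspace X. det (mat 1 + lin_part (F x)) \<in> - {0}}"
    by (rule openin_continuous_map_preimage) auto
  moreover have "openin X {x \<in> topspace X. sign_part (F x) \<in> {0<..}}"
    using c(1) by (rule openin_continuous_map_preimage) auto
  moreover have "{x \<in> topspace X. F x \<in> chart_nbhd} =
      {x \<in> topspace X. det (mat 1 + lin_part (F x)) \<in> - {0}} \<inter> {x \<in> topspace X. sign_part (F x) \<in> {0<..}}"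
    using assms by (auto simp: chart_nbhd_def is_family_def)
  ultimately show ?thesis by auto
qed

lemma openin_chart_domain_preimage:
  assumes "continuous_map X (Euclidean_space isometry_dim) a"
  shows "openin X {x \<in> topspace X. a x \<in> chart_domain}"
proof -
  interpret isometry_family \<gamma> "topspace X" "{f. continuous_map X euclideanreal f}"
    by (rule isometry_family_continuous)
  have "continuous_map X euclideanreal (\<lambda>x. a x i)" for i
    using assms unfolding Euclidean_space_def continuous_map_in_subtopology continuous_map_componentwise_UNIV
    by blast
  then have "mat_in (\<lambda>x. lie_of_coords (a x))"
    by (intro lie_of_coords_in) auto
  then have "continuous_map X euclideanreal (\<lambda>x. det (mat 1 + lie_of_coords (a x)))"
    using det[OF mat_add[OF mat_const]] by simp
  then have "openin X {x \<in> topspace X. det (mat 1 + lie_of_coords (a x)) \<in> - {0}}"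
    by (rule openin_continuous_map_preimage) auto
  moreover have "{x \<in> topspace X. a x \<in> chart_domain} = {x \<in> topspace X. det (mat 1 + lie_of_coords (a x)) \<in> - {0}}"
    using continuous_map_image_subset_topspace[OF assms] by (auto simp: chart_domain_def)
  ultimately show ?thesis by simp
qed

lemma openin_chart_domain: "openin (Euclidean_space isometry_dim) chart_domain"
proof -
  have "{x \<in> topspace (Euclidean_space isometry_dim). x \<in> chart_domain} = chart_domain"
    by (auto simp: chart_domain_def)
  then show ?thesis
    using openin_chart_domain_preimage[OF continuous_map_id] by simp
qed

text \<open>Charts at \<open>h\<close> are left translates by \<open>h\<close> of the chart at the identity.\<close>
definition chart_nbhd_at :: "('n heis \<Rightarrow> 'n heis) \<Rightarrow> ('n heis \<Rightarrow> 'n heis) set" where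
  "chart_nbhd_at h = {f \<in> I. inv_map h \<circ> f \<in> chart_nbhd}"

definition chart_at :: "('n heis \<Rightarrow> 'n heis) \<Rightarrow> ('n heis \<Rightarrow> 'n heis) \<Rightarrow> nat \<Rightarrow> real" where
  "chart_at h f = chart_coords (inv_map h \<circ> f)"

lemma inv_map_cancel: "h \<in> I \<Longrightarrow> inv_map h \<circ> (h \<circ> f) = f" "h \<in> I \<Longrightarrow> h \<circ> (inv_map h \<circ> f) = f"
  using isometry_inv(6,7)[of h] by (simp_all add: o_assoc)

lemma chart_inverse:
  assumes h: "h \<in> I"
  shows "p \<in> chart_domain \<Longrightarrow> h \<circ> chart_isometry p \<in> chart_nbhd_at h" "p \<in> chart_domain \<Longrightarrow> chart_at h (h \<circ> chart_isometry p) = p"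
    "f \<in> chart_nbhd_at h \<Longrightarrow> chart_at h f \<in> chart_domain" "f \<in> chart_nbhd_at h \<Longrightarrow> h \<circ> chart_isometry (chart_at h f) = f"
proof -
  show "h \<circ> chart_isometry p \<in> chart_nbhd_at h" "chart_at h (h \<circ> chart_isometry p) = p" if p: "p \<in> chart_domain"
    using chart_isometry_chart_nbhd[OF p] chart_coords_chart_isometry[OF p] isometry_comp(1)[OF h, of "chart_isometry p"]
    by (auto simp: chart_nbhd_at_def chart_at_def inv_map_cancel[OF h] chart_nbhd_def)
  show "chart_at h f \<in> chart_domain" "h \<circ> chart_isometry (chart_at h f) = f" if "f \<in> chart_nbhd_at h"
    using that chart_coords_chart_domain chart_isometry_chart_coords by (auto simp: chart_nbhd_at_def chart_at_def inv_map_cancel[OF h])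
qed

lemma chart_image: "h \<in> I \<Longrightarrow> chart_at h ` chart_nbhd_at h = chart_domain"
  using chart_inverse[of h] by (auto simp: image_iff) metis

lemma chart_inv_into:
  assumes "h \<in> I" "p \<in> chart_domain" shows "inv_into (chart_nbhd_at h) (chart_at h) p = h \<circ> chart_isometry p"
proof -
  have "inj_on (chart_at h) (chart_nbhd_at h)"
    using chart_inverse(4)[OF assms(1)] by (metis inj_onI)
  then show ?thesis
    using inv_into_f_eq chart_inverse(1,2)[OF assms] by metis
qed

lemma continuous_family_chart:
  assumes h: "h \<in> I" and F: "continuous_family X F"
  shows "openin X {x \<in> topspace X. F x \<in> chart_nbhd_at h}"
proof -
  interpret isometry_family \<gamma> "topspace X" "{f. continuous_map X euclideanreal f}"
    by (rule isometry_family_continuous)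
  have "is_family (\<lambda>x. inv_map h \<circ> F x)"
    by (intro family_comp family_const F isometry_inv h)
  from openin_chart_nbhd_preimage[OF this] show ?thesis
    using F by (simp add: chart_nbhd_at_def is_family_def cong: conj_cong)
qed

lemma is_chart_chart_at:
  assumes h: "h \<in> I"
  shows "is_chart T isometry_dim (chart_nbhd_at h, chart_at h)"
proof -
  have T: "continuous_family T (\<lambda>f. f)"
    unfolding continuous_family_iff using continuous_map_id by (simp add: id_def)
  have sub: "chart_nbhd_at h \<subseteq> topspace T" "chart_domain \<subseteq> topspace (Euclidean_space isometry_dim)"
    by (auto simp: chart_nbhd_at_def topspace_T chart_domain_def)
  have open_U: "openin T (chart_nbhd_at h)"
    using continuous_family_chart[OF h T] sub(1) by (simp add: Collect_conj_eq Int_absorb1)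
  let ?X = "subtopology T (chart_nbhd_at h)" and ?Y = "subtopology (Euclidean_space isometry_dim) chart_domain"
  have topX: "topspace ?X = chart_nbhd_at h" and topY: "topspace ?Y = chart_domain"
    using sub by auto
  have "homeomorphic_maps ?X ?Y (chart_at h) (\<lambda>p. h \<circ> chart_isometry p)"
    unfolding homeomorphic_maps_def
  proof (intro conjI ballI)
    show "continuous_map ?X ?Y (chart_at h)"
      unfolding continuous_map_in_subtopology topX
    proof
      interpret isometry_family \<gamma> "topspace ?X" "{f. continuous_map ?X euclideanreal f}"
        by (rule isometry_family_continuous)
      have "is_family (\<lambda>f. f)"
        unfolding continuous_family_iff using continuous_map_id_subt by (simp add: id_def)
      then have "is_family (\<lambda>f. inv_map h \<circ> f)"
        by (intro family_comp family_const isometry_inv h)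
      from chart_coords_in[OF this] have "continuous_map ?X euclideanreal (\<lambda>f. chart_at h f i)" for i
        unfolding topX by (simp add: chart_at_def chart_nbhd_at_def)
      then have "continuous_map ?X (Euclidean_space isometry_dim) (\<lambda>f i. if i < isometry_dim then chart_at h f i else 0)"
        unfolding continuous_map_componentwise_Euclidean_space by blast
      moreover have "(\<lambda>i. if i < isometry_dim then chart_at h f i else 0) = chart_at h f" for f
        by (auto simp: chart_at_def chart_coords_def)
      ultimately show "continuous_map ?X (Euclidean_space isometry_dim) (chart_at h)"
        by simp
      show "chart_at h \<in> chart_nbhd_at h \<rightarrow> chart_domain"
        using chart_inverse(3)[OF h] by blast
    qed
    show "continuous_map ?Y ?X (\<lambda>p. h \<circ> chart_isometry p)"
      unfolding continuous_map_in_subtopology topY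
    proof
      interpret isometry_family \<gamma> "topspace ?Y" "{f. continuous_map ?Y euclideanreal f}"
        by (rule isometry_family_continuous)
      have "continuous_map ?Y euclideanreal (\<lambda>p. p i)" for i
        unfolding Euclidean_space_def
        by (intro continuous_map_from_subtopology continuous_map_product_projection) simp
      then have "is_family chart_isometry"
        using family_chart_isometry[of "\<lambda>p. p"] topY by simp
      then have "is_family (\<lambda>p. h \<circ> chart_isometry p)"
        by (intro family_comp family_const h)
      then show "continuous_map ?Y T (\<lambda>p. h \<circ> chart_isometry p)"
        unfolding continuous_family_iff .
      show "(\<lambda>p. h \<circ> chart_isometry p) \<in> chart_domain \<rightarrow> chart_nbhd_at h"
        using chart_inverse(1)[OF h] by blast
    qed
    show "h \<circ> chart_isometry (chart_at h f) = f" if "f \<in> topspace ?X" for f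
      using that chart_inverse(4)[OF h] topX by blast
    show "chart_at h (h \<circ> chart_isometry p) = p" if "p \<in> topspace ?Y" for p
      using that chart_inverse(2)[OF h] topY by blast
  qed
  then show ?thesis
    using open_U openin_chart_domain homeomorphic_maps_imp_map by (simp add: is_chart_def chart_image[OF h])
qed

definition atlas :: "('n heis \<Rightarrow> 'n heis) chart set" where
  "atlas = (\<lambda>h. (chart_nbhd_at h, chart_at h)) ` I"

text \<open>Every smoothness condition on the atlas is of this form: a family of isometries, built from chart
  inverses by group operations, is followed by a chart. The set where the chart applies is open
  because the family is continuous, and there the chart coordinates are rational functions.\<close>
lemma chart_smooth:
  assumes S: "openin (Euclidean_space m) S" and F: "isometry_family.is_family \<gamma> S {f. rational_on m S f} F"
    and h: "h \<in> I" and eq: "\<And>p. p \<in> S \<Longrightarrow> F p \<in> chart_nbhd_at h \<Longrightarrow> H p = chart_at h (F p)"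
  shows "coord_smooth_on m isometry_dim {p \<in> S. F p \<in> chart_nbhd_at h} H"
proof -
  let ?X = "subtopology (Euclidean_space m) S" and ?S = "{p \<in> S. F p \<in> chart_nbhd_at h}"
  have topX: "topspace ?X = S"
    using openin_subset[OF S] by auto
  interpret R: isometry_family \<gamma> S "{f. rational_on m S f}"
    by (rule isometry_family_rational)
  interpret C: isometry_family \<gamma> S "{f. continuous_map ?X euclideanreal f}"
    using isometry_family_continuous[of ?X] by (simp only: topX)
  interpret R': isometry_family \<gamma> ?S "{f. rational_on m ?S f}"
    by (rule isometry_family_rational)
  have "C.is_family F"
    using F rational_continuous[of m S] by (auto simp: R.is_family_def C.is_family_def R.vec_in_def C.vec_in_def
        R.mat_in_def C.mat_in_def)
  then have "continuous_family ?X F"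
    by (simp only: topX)
  from continuous_family_chart[OF h this] have S': "openin (Euclidean_space m) ?S"
    unfolding topX using openin_open_subtopology[OF S] by blast
  have "R'.is_family F"
    using F rational_subset[of m S _ ?S] by (auto simp: R.is_family_def R'.is_family_def R.vec_in_def R'.vec_in_def
        R.mat_in_def R'.mat_in_def)
  then have "R'.is_family (\<lambda>p. inv_map h \<circ> F p)"
    by (intro R'.family_comp R'.family_const isometry_inv h)
  then have "(\<lambda>p. chart_at h (F p) j) \<in> {f. rational_on m ?S f}" for j
    unfolding chart_at_def by (rule R'.chart_coords_in) (simp add: chart_nbhd_at_def)
  then have "(\<lambda>p. H p j) \<in> {f. rational_on m ?S f}" for j
    by (rule R'.cong) (simp add: eq)
  then show ?thesis
    unfolding coord_smooth_on_def using rational_imp_coord_Ck_on[OF _ S'] by simp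
qed

lemma rational_family_chart_isometry:
  assumes "\<And>i. i < isometry_dim \<Longrightarrow> rational_on m S (\<lambda>p. a p i)" and "\<And>p. p \<in> S \<Longrightarrow> a p \<in> chart_domain"
  shows "isometry_family.is_family \<gamma> S {f. rational_on m S f} (\<lambda>p. chart_isometry (a p))"
  by (rule isometry_family.family_chart_isometry[OF isometry_family_rational]) (use assms in auto)

lemma rational_family_chart:
  assumes "h \<in> I"
  shows "isometry_family.is_family \<gamma> chart_domain {f. rational_on isometry_dim chart_domain f} (\<lambda>p. h \<circ> chart_isometry p)"
  by (intro isometry_family.family_comp[OF isometry_family_rational] isometry_family.family_const[OF isometry_family_rational]
      rational_family_chart_isometry[of isometry_dim chart_domain "\<lambda>p. p"] assms rational_on.coord)

lemma smooth_atlas: "smooth_atlas T isometry_dim atlas"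
  unfolding smooth_atlas_def
proof (intro conjI)
  show "\<forall>c\<in>atlas. is_chart T isometry_dim c"
    using is_chart_chart_at by (simp add: atlas_def)
  have "sign_part id = 1" "lin_part id = mat 1"
    using affine_iso_parts(3,4)[of 0 0 "mat 1" 1] by (simp_all only: affine_iso_id)
  then have "id \<in> chart_nbhd"
    by (simp add: chart_nbhd_def id_isometry det_nz_iff one_plus scaleR_2[symmetric])
  then have "h \<in> chart_nbhd_at h" if h: "h \<in> I" for h
    using isometry_inv(7)[OF h] h by (simp add: chart_nbhd_at_def)
  then show "\<Union> (fst ` atlas) = topspace T"
    by (auto simp: atlas_def topspace_T chart_nbhd_at_def)
  have "coord_smooth_on isometry_dim isometry_dim (chart_at h ` (chart_nbhd_at h \<inter> chart_nbhd_at k)) (\<lambda>p. chart_at k (inv_into (chart_nbhd_at h) (chart_at h) p))"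
    if hk: "h \<in> I" "k \<in> I" for h k
  proof -
    have S: "chart_at h ` (chart_nbhd_at h \<inter> chart_nbhd_at k) = {p \<in> chart_domain. h \<circ> chart_isometry p \<in> chart_nbhd_at k}"
      using chart_inverse[OF hk(1)] by (auto simp: image_iff) (metis IntI)
    show ?thesis
      unfolding S by (intro chart_smooth openin_chart_domain rational_family_chart hk) (simp add: chart_inv_into hk)
  qed
  then show "\<forall>(U, \<phi>)\<in>atlas. \<forall>(V, \<psi>)\<in>atlas.
      coord_smooth_on isometry_dim isometry_dim (\<phi> ` (U \<inter> V)) (\<lambda>p. \<psi> (inv_into U \<phi> p))"
    by (simp add: atlas_def)
qed

lemma smooth_inverse: "smooth_inverse GI isometry_dim atlas"
proof -
  have "coord_smooth_on isometry_dim isometry_dim {p \<in> chart_at h ` chart_nbhd_at h. m_inv GI (inv_into (chart_nbhd_at h) (chart_at h) p) \<in> chart_nbhd_at k}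
      (\<lambda>p. chart_at k (m_inv GI (inv_into (chart_nbhd_at h) (chart_at h) p)))"
    if hk: "h \<in> I" "k \<in> I" for h k
  proof -
  have eq: "m_inv GI (inv_into (chart_nbhd_at h) (chart_at h) p) = inv_map (h \<circ> chart_isometry p)" if "p \<in> chart_domain" for p
  proof -
    have "h \<circ> chart_isometry p \<in> I"
      using chart_inverse(1)[OF hk(1) that] by (simp add: chart_nbhd_at_def)
    then show ?thesis
      using that by (simp add: chart_inv_into hk m_inv_GI)
  qed
  have S: "{p \<in> chart_at h ` chart_nbhd_at h. m_inv GI (inv_into (chart_nbhd_at h) (chart_at h) p) \<in> chart_nbhd_at k} =
      {p \<in> chart_domain. inv_map (h \<circ> chart_isometry p) \<in> chart_nbhd_at k}"
    unfolding chart_image[OF hk(1)] using eq by auto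
  show ?thesis
    unfolding S
    by (intro chart_smooth openin_chart_domain isometry_family.family_inv[OF isometry_family_rational] rational_family_chart hk)
      (simp add: eq)
  qed
  then show ?thesis
    by (simp add: smooth_inverse_def atlas_def)
qed

lemma smooth_mult: "smooth_mult GI isometry_dim atlas"
proof -
  let ?E = "Euclidean_space (isometry_dim + isometry_dim)" and ?a = "first_half isometry_dim" and ?b = "second_half isometry_dim"
  have "coord_smooth_on (isometry_dim + isometry_dim) isometry_dim
      {p \<in> topspace ?E. ?a p \<in> chart_at h ` chart_nbhd_at h \<and> ?b p \<in> chart_at k ` chart_nbhd_at k \<and>
        inv_into (chart_nbhd_at h) (chart_at h) (?a p) \<otimes>\<^bsub>GI\<^esub> inv_into (chart_nbhd_at k) (chart_at k) (?b p) \<in> chart_nbhd_at l}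
      (\<lambda>p. chart_at l (inv_into (chart_nbhd_at h) (chart_at h) (?a p) \<otimes>\<^bsub>GI\<^esub> inv_into (chart_nbhd_at k) (chart_at k) (?b p)))"
    if hk: "h \<in> I" "k \<in> I" "l \<in> I" for h k l
  proof -
  define S where "S = {p \<in> topspace ?E. ?a p \<in> chart_domain} \<inter> {p \<in> topspace ?E. ?b p \<in> chart_domain}"
  define F where "F p = (h \<circ> chart_isometry (?a p)) \<circ> (k \<circ> chart_isometry (?b p))" for p
  have proj: "continuous_map ?E euclideanreal (\<lambda>p. p i)" for i
    unfolding Euclidean_space_def
    by (intro continuous_map_from_subtopology continuous_map_product_projection) simp
  have "continuous_map ?E (Euclidean_space isometry_dim) ?a" "continuous_map ?E (Euclidean_space isometry_dim) ?b"
    unfolding first_half_def second_half_def continuous_map_componentwise_Euclidean_space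
    using proj by blast+
  then have S: "openin ?E S"
    unfolding S_def by (intro openin_Int openin_chart_domain_preimage)
  have ab: "?a p \<in> chart_domain" "?b p \<in> chart_domain" if "p \<in> S" for p
    using that by (auto simp: S_def)
  have "rational_on (isometry_dim + isometry_dim) S (\<lambda>p. ?a p i)" "rational_on (isometry_dim + isometry_dim) S (\<lambda>p. ?b p i)" if "i < isometry_dim" for i
    using that by (auto simp: first_half_def second_half_def intro: rational_on.coord)
  then have F: "isometry_family.is_family \<gamma> S {f. rational_on (isometry_dim + isometry_dim) S f} F"
    unfolding F_def
    by (intro isometry_family.family_comp[OF isometry_family_rational] isometry_family.family_const[OF isometry_family_rational]
        rational_family_chart_isometry ab hk)
  have eq: "inv_into (chart_nbhd_at h) (chart_at h) (?a p) \<otimes>\<^bsub>GI\<^esub> inv_into (chart_nbhd_at k) (chart_at k) (?b p) = F p" if "p \<in> S" for p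
    using ab[OF that] by (simp add: F_def chart_inv_into hk)
  have S_eq: "{p \<in> topspace ?E. ?a p \<in> chart_at h ` chart_nbhd_at h \<and> ?b p \<in> chart_at k ` chart_nbhd_at k \<and>
      inv_into (chart_nbhd_at h) (chart_at h) (?a p) \<otimes>\<^bsub>GI\<^esub> inv_into (chart_nbhd_at k) (chart_at k) (?b p) \<in> chart_nbhd_at l} = {p \<in> S. F p \<in> chart_nbhd_at l}"
    unfolding chart_image[OF hk(1)] chart_image[OF hk(2)] using eq by (auto simp: S_def)
  show ?thesis
    unfolding S_eq
    by (intro chart_smooth S F hk) (simp only: eq)
  qed
  then show ?thesis
    by (simp add: smooth_mult_def atlas_def del: isometry_group_simps)
qed

theorem lie_group_GI: "lie_group_of_dim GI T isometry_dim"
  unfolding lie_group_of_dim_def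
  using topological_group_GI Hausdorff_T second_countable_T smooth_atlas smooth_mult smooth_inverse by blast

end

section \<open>Invariance, index and dimension\<close>

context heis_metric
begin

lemma heis_mult_affine_iso: "heis_mult p = affine_iso (hcoord p) (vcoord p) (mat 1) 1"
  by (rule HOL.ext) (simp add: heis_mult_eq affine_iso_def)

lemma left_invariant_diag_metric: "left_invariant diag_metric"
  using affine_iso_isometry[OF admissible_id] unfolding left_invariant_def heis_mult_affine_iso isometries_def
  by blast

lemma bilinear_diag_metric: "bilinear (diag_metric q)"
  unfolding bilinear_def diag_metric_def
  by (intro conjI allI linearI; simp)+

lemma pseudo_riemannian_metric_diag_metric: "pseudo_riemannian_metric heis_H diag_metric"
  unfolding pseudo_riemannian_metric_def
proof (intro conjI allI ballI impI)
  fix q v assume v: "v \<in> heis_H q" "\<forall>w\<in>heis_H q. diag_metric q v w = 0"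
  then obtain u where u: "v = hlift q u"
    by (auto simp: heis_H_eq)
  have "G u w = 0" for w
    using v(2) unfolding heis_H_eq u by (simp add: diag_metric_def hlift_def)
  then have "u = 0"
    by (rule G_nondegenerate)
  then show "v = 0"
    using u linear_0[OF linear_hlift] by simp
next
  fix V W :: "'n heis \<Rightarrow> 'n heis"
  assume "smooth V \<and> smooth W \<and> (\<forall>q. V q \<in> heis_H q \<and> W q \<in> heis_H q)"
  moreover have "bounded_bilinear (diag_metric 0)"
    using bilinear_diag_metric bilinear_conv_bounded_bilinear by blast
  ultimately have "smooth (\<lambda>q. diag_metric 0 (V q) (W q))"
    using smooth_bounded_bilinear[of "diag_metric 0" V W] by blast
  then show "smooth (\<lambda>q. diag_metric q (V q) (W q))"
    by (simp add: diag_metric_def)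
qed (simp_all add: diag_metric_def G_commute)

lemma has_index_diag_metric: "has_index heis_H diag_metric (card {k. \<gamma> k < 0})"
  unfolding has_index_def
proof
  fix q :: "'n heis"
  let ?b = "\<lambda>k. hlift q (axis k 1)"
  have hcoord_b: "hcoord (?b k) = axis k 1" for k
    by (simp add: hlift_def)
  have G: "diag_metric q (?b k) (?b l) = (if k = l then \<gamma> k else 0)" for k l
    by (simp add: diag_metric_def hcoord_b G_axis) (simp add: axis_def)
  have inj: "inj ?b"
    by (rule injI, drule arg_cong[where f = hcoord]) (simp add: hcoord_b axis_eq_axis)
  have Basis: "range (\<lambda>k. axis k 1) = (Basis :: (real ^ ('n + 'n)) set)"
    by (auto simp: Basis_vec_def)
  have "inj (hlift q)"
    by (rule injI, drule arg_cong[where f = hcoord]) (simp add: hlift_def)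
  then have "independent (hlift q ` Basis)"
    by (intro linear_independent_injective_image linear_hlift independent_Basis) simp
  then have ind: "independent (range ?b)"
    unfolding Basis[symmetric] image_image .
  have span: "span (range ?b) = heis_H q"
    unfolding heis_H_eq using linear_span_image[OF linear_hlift, of q Basis]
    by (simp add: Basis[symmetric] image_image) (simp add: Basis)
  have "{b \<in> range ?b. diag_metric q b b < 0} = ?b ` {k. \<gamma> k < 0}"
    by (auto simp: G)
  then have "card {b \<in> range ?b. diag_metric q b b < 0} = card {k. \<gamma> k < 0}"
    using card_image[OF inj_on_subset[OF inj subset_UNIV]] by metis
  then show "\<exists>B. independent B \<and> span B = heis_H q \<and> (\<forall>b\<in>B. \<forall>c\<in>B. b \<noteq> c \<longrightarrow> diag_metric q b c = 0) \<and>
      card {b \<in> B. diag_metric q b b < 0} = card {k. \<gamma> k < 0}"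
    using ind span by (intro exI[of _ "range ?b"]) (auto simp: G)
qed

text \<open>The pairs of planes of the same type form two squares, one for each type.\<close>
lemma isometry_dim_eq:
  "isometry_dim = 2 * CARD('n) + 1 + card {i. \<gamma> (Inl i) = \<gamma> (Inr i)} ^ 2 + card {i. \<gamma> (Inl i) \<noteq> \<gamma> (Inr i)} ^ 2"
proof -
  let ?E = "{i. \<gamma> (Inl i) = \<gamma> (Inr i)}" and ?T = "{i. \<gamma> (Inl i) \<noteq> \<gamma> (Inr i)}"
  have "same_type i j \<longleftrightarrow> (\<gamma> (Inl i) = \<gamma> (Inr i) \<longleftrightarrow> \<gamma> (Inl j) = \<gamma> (Inr j))" for i j
    using \<gamma>[of "Inl i"] \<gamma>[of "Inl j"] \<gamma>[of "Inr i"] \<gamma>[of "Inr j"] by (auto simp: same_type_def)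
  then have "{(i, j). same_type i j} = ?E \<times> ?E \<union> ?T \<times> ?T"
    by auto
  also have "card \<dots> = card ?E ^ 2 + card ?T ^ 2"
    by (subst card_Un_disjoint) (auto simp: power2_eq_square)
  finally have "card {(i, j). same_type i j} = card ?E ^ 2 + card ?T ^ 2" .
  moreover have "card chart_index = card (range Inl :: ((('n + 'n) + unit) + 'n \<times> 'n) set) +
      card (Inr ` {(i, j). same_type i j} :: ((('n + 'n) + unit) + 'n \<times> 'n) set)"
    unfolding chart_index_def by (rule card_Un_disjoint) auto
  ultimately show ?thesis
    by (simp add: isometry_dim_def card_image)
qed

end

theorem mainTheorem2:
  fixes l t :: nat
  assumes "l \<le> 2 * CARD('n::finite)"
    and "t \<le> min l (2 * CARD('n) - l)"
    and "even (l - t)"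
  shows "\<exists>g :: 'n heis \<Rightarrow> 'n heis \<Rightarrow> 'n heis \<Rightarrow> real.
    pseudo_riemannian_metric heis_H g \<and> left_invariant g \<and> has_index heis_H g l \<and>
    lie_group_of_dim (isometry_group heis_H g) (compact_open_topology (isometries heis_H g))
      (2 * CARD('n) + 1 + (CARD('n) - t)\<^sup>2 + t\<^sup>2)"
proof -
  \<comment> \<open>\<open>T\<close> indexes the indefinite planes and \<open>N\<close> the negative definite ones\<close>
  obtain m where m: "l - t = 2 * m"
    using assms(3) unfolding dvd_def by blast
  have le: "t \<le> CARD('n)" "m \<le> CARD('n) - t" "t \<le> l"
    using assms(1,2) m by auto
  obtain T :: "'n set" where T: "card T = t"
    using obtain_subset_with_card_n[OF le(1)] by auto
  have "card (- T) = CARD('n) - t"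
    using T by (simp add: Compl_eq_Diff_UNIV card_Diff_subset)
  then obtain N where N: "N \<subseteq> - T" "card N = m"
    using obtain_subset_with_card_n[of m "- T"] le(2) by auto
  define \<gamma> :: "'n + 'n \<Rightarrow> real" where
    "\<gamma> k = (case k of Inl i \<Rightarrow> if i \<in> N then -1 else 1 | Inr i \<Rightarrow> if i \<in> N \<union> T then -1 else 1)" for k
  interpret heis_metric \<gamma>
    by unfold_locales (auto simp: \<gamma>_def split: sum.split)
  have "\<gamma> k < 0 \<longleftrightarrow> k \<in> Inl ` N \<union> Inr ` (N \<union> T)" for k
    by (cases k) (auto simp: \<gamma>_def)
  then have "{k. \<gamma> k < 0} = Inl ` N \<union> Inr ` (N \<union> T)"
    by blast
  also have "card \<dots> = card N + card (N \<union> T)"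
    by (subst card_Un_disjoint) (auto simp: card_image)
  also have "card (N \<union> T) = card N + card T"
    using N by (intro card_Un_disjoint) auto
  also have "card N + (card N + card T) = l"
    using N T m le by simp
  finally have index: "card {k. \<gamma> k < 0} = l" .
  have "{i. \<gamma> (Inl i) = \<gamma> (Inr i)} = - T" "{i. \<gamma> (Inl i) \<noteq> \<gamma> (Inr i)} = T"
    using N by (auto simp: \<gamma>_def)
  then have "isometry_dim = 2 * CARD('n) + 1 + (CARD('n) - t)\<^sup>2 + t\<^sup>2"
    using T \<open>card (- T) = CARD('n) - t\<close> by (simp only: isometry_dim_eq)
  then show ?thesis
    using pseudo_riemannian_metric_diag_metric left_invariant_diag_metric has_index_diag_metric lie_group_GI index by metis
qed

end
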